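(* Let $e^{-\psi}:\mathbb{R}^{n+2}\to[0,\infty)$ be a log-concave density and let $E$ be an $n$-dimensional linear subspace of $\mathbb{R}^{n+2}$. For every nonzero $u\in E^{\perp}$, denote by $H_u$ the closed $(n+1)$-dimensional half-space $E+\mathbb{R}^+u=\{e+ru: e\in E,\ r\ge0\}$. Let $x_0,x_1\in E^{\perp}$ be linearly independent and let $x_\lambda=(1-\lambda)x_0+\lambda x_1$ for some $\lambda\in(0,1)$. Assume that $K_0,K_\lambda,K_1$ are (relatively) open and connected subsets of $H_{x_0},H_{x_\lambda},H_{x_1}$ respectively. If for every $t\in(0,1)$ $$\left((1-t)K_0+tK_1\right)\cap H_{x_\lambda}\subseteq K_\lambda,$$ then $$\frac{|x_\lambda|}{\int_{K_\lambda}e^{-\psi}}\ \le\ (1-\lambda)\frac{|x_0|}{\int_{K_0}e^{-\psi}}+\lambda\frac{|x_1|}{\int_{K_1}e^{-\psi}}.$$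
   Context: $|\cdot|$ is the Euclidean norm and $E^\perp$ is the orthogonal complement of $E$ (of dimension 2). "Log-concave density" means that the function $e^{-\psi}$ is log-concave, i.e. $\psi$ is convex with values in $(-\infty,\infty]$. The integrals over $K_0,K_\lambda,K_1$ are with respect to the $(n+1)$-dimensional Hausdorff measure on the respective half-spaces. $(1-t)K_0+tK_1$ denotes the Minkowski combination $\{(1-t)a+tb:a\in K_0,\ b\in K_1\}$. Quotients are taken in $[0,\infty]$ with the conventions $c/0=\infty$ and $c/\infty=0$ for $c>0$. *)

theory Defs
  imports "HOL-Analysis.Analysis"
begin

(* The empty set is treated separately only because of d = 0, where diameter {} ^ 0 = 1. *)
definition hausdorff_gauge :: "nat \<Rightarrow> 'a::metric_space set \<Rightarrow> ennreal" where
  "hausdorff_gauge d C =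
     (if C = {} then 0 else ennreal (unit_ball_vol (real d) * (diameter C / 2) ^ d))"

(* Boundedness of the covering sets is explicit because diameter is a junk value on unbounded
   sets.  Finite covers are included, since the C i may be empty. *)
definition hausdorff_premeasure :: "nat \<Rightarrow> real \<Rightarrow> 'a::metric_space set \<Rightarrow> ennreal" where
  "hausdorff_premeasure d \<delta> S =
     (INF C\<in>{C :: nat \<Rightarrow> 'a set. S \<subseteq> (\<Union>i. C i) \<and> (\<forall>i. bounded (C i) \<and> diameter (C i) \<le> \<delta>)}.
        \<Sum>i. hausdorff_gauge d (C i))"

(* The premeasure increases as the mesh decreases to 0, so its limit is the supremum. *)
definition hausdorff_outer :: "nat \<Rightarrow> 'a::metric_space set \<Rightarrow> ennreal" where
  "hausdorff_outer d S = (SUP \<delta>\<in>{0<..}. hausdorff_premeasure d \<delta> S)"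

(* The measure lives on all Caratheodory-measurable sets, not just the Borel sets: a log-concave
   function need not be Borel on the boundary of its support, but it is measurable here once
   restricted to a half-space. *)
definition hausdorff_measure :: "nat \<Rightarrow> 'a::metric_space measure" where
  "hausdorff_measure d =
     measure_of UNIV (lambda_system UNIV UNIV (hausdorff_outer d)) (hausdorff_outer d)"

lemma hausdorff_premeasure_empty: "\<delta> > 0 \<Longrightarrow> hausdorff_premeasure d \<delta> {} = 0"
  unfolding hausdorff_premeasure_def
  by (rule antisym, rule INF_lower2[where i="\<lambda>_. {}"]) (auto simp: hausdorff_gauge_def)

lemma hausdorff_premeasure_mono:
  "S \<subseteq> T \<Longrightarrow> hausdorff_premeasure d \<delta> S \<le> hausdorff_premeasure d \<delta> T"
  unfolding hausdorff_premeasure_def by (rule INF_superset_mono) auto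

lemma hausdorff_premeasure_subadditive:
  "hausdorff_premeasure d \<delta> (\<Union>i::nat. A i) \<le> (\<Sum>i. hausdorff_premeasure d \<delta> (A i))"
proof (rule ennreal_le_epsilon)
  fix e :: real
  assume fin: "(\<Sum>i. hausdorff_premeasure d \<delta> (A i)) < top" and "0 < e"
  let ?P = "hausdorff_premeasure d \<delta>"
  let ?cov = "\<lambda>S C. S \<subseteq> (\<Union>i::nat. C i) \<and> (\<forall>i. bounded (C i) \<and> diameter (C i) \<le> \<delta>)"
  have "\<exists>C. ?cov (A i) C \<and> (\<Sum>j. hausdorff_gauge d (C j)) \<le> ?P (A i) + ennreal (e * (1/2) ^ Suc i)"
    for i
  proof -
    have "?P (A i) < top"
      using fin ennreal_suminf_lessD by blast
    then have "?P (A i) < ?P (A i) + ennreal (e * (1/2) ^ Suc i)"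
      using \<open>0 < e\<close> by (simp add: ennreal_less_zero_iff less_top)
    then show ?thesis
      unfolding hausdorff_premeasure_def INF_less_iff by (auto intro: less_imp_le)
  qed
  then obtain C where C: "\<And>i. ?cov (A i) (C i)"
    "\<And>i. (\<Sum>j. hausdorff_gauge d (C i j)) \<le> ?P (A i) + ennreal (e * (1/2) ^ Suc i)"
    by metis
  define D where "D = (\<lambda>n. case prod_decode n of (i, j) \<Rightarrow> C i j)"
  have "?cov (\<Union>i. A i) D"
  proof (intro conjI subsetI allI)
    fix x assume "x \<in> (\<Union>i. A i)"
    then obtain i j where "x \<in> C i j"
      using C(1) by blast
    then have "x \<in> D (prod_encode (i, j))"
      by (simp add: D_def)
    then show "x \<in> (\<Union>n. D n)"
      by blast
  qed (use C(1) in \<open>auto simp: D_def split: prod.split\<close>)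
  then have "?P (\<Union>i. A i) \<le> (\<Sum>n. hausdorff_gauge d (D n))"
    unfolding hausdorff_premeasure_def by (intro INF_lower) auto
  also have "\<dots> = (\<Sum>i. \<Sum>j. hausdorff_gauge d (C i j))"
    using suminf_ennreal_2dimen[of "\<lambda>i. \<Sum>j. hausdorff_gauge d (C i j)"
        "\<lambda>p. hausdorff_gauge d (C (fst p) (snd p))"]
    by (simp add: D_def comp_def case_prod_beta)
  also have "\<dots> \<le> (\<Sum>i. ?P (A i) + ennreal (e * (1/2) ^ Suc i))"
    by (intro suminf_le C(2)) auto
  also have "\<dots> = (\<Sum>i. ?P (A i)) + (\<Sum>i. ennreal (e * (1/2) ^ Suc i))"
    by (rule suminf_add[symmetric]) auto
  also have "(\<Sum>i. ennreal (e * (1/2) ^ Suc i)) = ennreal e"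
    using sums_mult[OF power_half_series, of e] \<open>0 < e\<close>
    by (intro suminf_ennreal_eq) auto
  finally show "?P (\<Union>i. A i) \<le> (\<Sum>i. ?P (A i)) + ennreal e" .
qed

lemma outer_measure_space_hausdorff_outer:
  "outer_measure_space UNIV (hausdorff_outer d :: 'a::metric_space set \<Rightarrow> ennreal)"
  unfolding outer_measure_space_def
proof (intro conjI)
  show "positive UNIV (hausdorff_outer d :: 'a set \<Rightarrow> ennreal)"
    by (simp add: positive_def hausdorff_outer_def hausdorff_premeasure_empty)
  show "increasing UNIV (hausdorff_outer d :: 'a set \<Rightarrow> ennreal)"
    by (auto simp: increasing_def hausdorff_outer_def
        intro!: SUP_subset_mono hausdorff_premeasure_mono)
  have "hausdorff_outer d (\<Union>i. A i) \<le> (\<Sum>i. hausdorff_outer d (A i))"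
    for A :: "nat \<Rightarrow> 'a set"
    unfolding hausdorff_outer_def
    by (rule SUP_least, rule order_trans[OF hausdorff_premeasure_subadditive])
       (intro suminf_le SUP_upper, auto)
  then show "countably_subadditive UNIV (hausdorff_outer d :: 'a set \<Rightarrow> ennreal)"
    by (simp add: countably_subadditive_def)
qed

lemma
  shows space_hausdorff_measure [simp]: "space (hausdorff_measure d :: 'a::metric_space measure) = UNIV"
    and sets_hausdorff_measure:
      "sets (hausdorff_measure d :: 'a measure) = lambda_system UNIV UNIV (hausdorff_outer d)"
    and emeasure_hausdorff_measure:
      "(S :: 'a set) \<in> sets (hausdorff_measure d) \<Longrightarrow>
        emeasure (hausdorff_measure d) S = hausdorff_outer d S"
proof -
  let ?L = "lambda_system UNIV UNIV (hausdorff_outer d) :: 'a set set"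
  have ms: "measure_space UNIV ?L (hausdorff_outer d)"
    using sigma_algebra.caratheodory_lemma[of UNIV UNIV "hausdorff_outer d :: 'a set \<Rightarrow> ennreal"]
      outer_measure_space_hausdorff_outer[where 'a='a] sigma_algebra_Pow[of "UNIV :: 'a set"] by auto
  then interpret sigma_algebra UNIV ?L
    by (simp add: measure_space_def)
  show "space (hausdorff_measure d :: 'a measure) = UNIV"
    by (simp add: hausdorff_measure_def space_measure_of_conv)
  show sets: "sets (hausdorff_measure d) = ?L"
    by (simp add: hausdorff_measure_def sets_measure_of_eq)
  show "emeasure (hausdorff_measure d) S = hausdorff_outer d S"
    if "S \<in> sets (hausdorff_measure d)"
    using that ms unfolding sets hausdorff_measure_def
    by (intro emeasure_measure_of_sigma) (auto simp: measure_space_def)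
qed

(* Library convexity is for real-valued functions only; here the value \<infinity> is allowed.
   At t = 0 and t = 1 the convention 0 * \<infinity> = 0 of ereal makes the inequality trivial. *)
definition convex_ereal :: "('a::real_vector \<Rightarrow> ereal) \<Rightarrow> bool" where
  "convex_ereal \<psi> \<longleftrightarrow> (\<forall>x. \<psi> x \<noteq> -\<infinity>) \<and>
     (\<forall>x y. \<forall>t\<in>{0..1}. \<psi> ((1 - t) *\<^sub>R x + t *\<^sub>R y) \<le> ereal (1 - t) * \<psi> x + ereal t * \<psi> y)"

(* exp (- s), meant for s > -\<infinity>. *)
definition exp_minus :: "ereal \<Rightarrow> real" where
  "exp_minus s = (if s = \<infinity> then 0 else exp (- real_of_ereal s))"

definition half_space :: "'a::real_vector set \<Rightarrow> 'a \<Rightarrow> 'a set" where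
  "half_space E u = {e + r *\<^sub>R u |e r. e \<in> E \<and> 0 \<le> r}"

end

theory Submission
  imports Defs
begin

text \<open>Every point of the half-space through \<open>x\<^sub>i\<close> is \<open>e + r *\<^sub>R x\<^sub>i\<close> with \<open>e \<in> E\<close> and \<open>r \<ge> 0\<close>. The point
\<open>(1 - t) *\<^sub>R (e\<^sub>0 + r\<^sub>0 *\<^sub>R x\<^sub>0) + t *\<^sub>R (e\<^sub>1 + r\<^sub>1 *\<^sub>R x\<^sub>1)\<close> lies on the middle half-space, at height \<open>r\<close>,
exactly when \<open>(1 - t) * r\<^sub>0 = (1 - l) * r\<close> and \<open>t * r\<^sub>1 = l * r\<close>. Adding the two equations divided by
\<open>r\<^sub>0\<close> and \<open>r\<^sub>1\<close> gives \<open>1 / r = (1 - l) / r\<^sub>0 + l / r\<^sub>1\<close>: the heights combine harmonically, so their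
reciprocals \<open>s = 1 / r\<close> combine affinely.

Let \<open>\<Phi>\<^sub>i r\<close> be the integral of the density over the section of \<open>K\<^sub>i\<close> at height \<open>r\<close>, which is a
translate of a subset of \<open>E\<close>. For heights related as above, log-concavity and the Prekopa-Leindler
inequality along \<open>E\<close>, with weight \<open>t\<close>, give \<open>\<Phi>\<^sub>l r \<ge> \<Phi>\<^sub>0 r\<^sub>0 powr (1 - t) * \<Phi>\<^sub>1 r\<^sub>1 powr t\<close>
(\<open>section_integral_prekopa_leindler\<close>). Substituting \<open>r = 1 / s\<close> replaces \<open>\<Phi>\<^sub>i\<close> by
\<open>\<Phi>\<^sub>i (1 / s) / s\<^sup>2\<close>, and the weighted arithmetic-geometric inequality absorbs the dependence of \<open>t\<close> on
the heights: at affine combinations of \<open>s\<^sub>0\<close> and \<open>s\<^sub>1\<close> with the fixed weight \<open>l\<close>, the new middle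
function dominates the power mean of exponent \<open>-1/2\<close> of the other two. The one-dimensional
Borell-Brascamp-Lieb inequality turns exponent \<open>-1/2\<close> for functions into exponent \<open>-1\<close> for their
integrals (\<open>radial_inequality\<close>). Hence the radial integrals \<open>J\<^sub>i\<close> of \<open>\<Phi>\<^sub>i\<close> satisfy
\<open>1 / J\<^sub>l \<le> (1 - l) / J\<^sub>0 + l / J\<^sub>1\<close>.

It remains to see that the Hausdorff integral over \<open>K\<^sub>i\<close> is \<open>c * norm x\<^sub>i * J\<^sub>i\<close> with one finite constant
\<open>c\<close> for all three half-spaces (\<open>nn_integral_hausdorff_half_space\<close>). On the hyperplane spanned by \<open>E\<close>
and a unit vector, Hausdorff measure and Lebesgue measure are both translation invariant and locally
finite, so they are proportional; rotating one hyperplane onto another shows that the factor does not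
change. The claimed inequality is homogeneous in \<open>c\<close>, so only the finiteness of \<open>c\<close> matters.

Lebesgue measure on \<open>E\<close> is represented, up to a factor, by the image under the orthogonal projection
of Lebesgue measure on the tube of radius one around \<open>E\<close>; so everything becomes an integral over the
full space. And since \<open>\<psi>\<close> may behave badly on the boundary of its domain of
finiteness, the density is set to zero there; this changes it only on the frontier of a convex set,
a null set, and leaves a function that is continuous on an open set and zero elsewhere.\<close>

section \<open>Level sets and integral inequalities on the line\<close>

text \<open>A set of reals and the union of its initial segments below its own points differ in at most one point,
the maximum. With the mirrored lemma for \<open>greaterThan\<close> this allows the sets in the one-dimensional
Brunn-Minkowski inequality to be cut at their own points.\<close>
lemma emeasure_eq_SUP_lessThan:
  fixes A :: "real set"
  assumes A: "A \<in> sets borel" and ne: "A \<noteq> {}"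
  shows "emeasure lborel A = (SUP a\<in>A. emeasure lborel (A \<inter> {..<a}))"
proof (rule antisym)
  define U where "U = (\<Union>a\<in>A. {..<a})"
  obtain F where F: "F \<subseteq> lessThan ` A" "countable F" "\<Union>F = U"
    using Lindelof[of "lessThan ` A"] unfolding U_def by (metis imageE open_lessThan)
  have U_ne: "U \<noteq> {}" using ne by (auto simp: U_def intro: lt_ex)
  obtain D where D: "D \<subseteq> A" "countable D" "F = lessThan ` D"
    using F countable_subset_image by metis
  have Dne: "D \<noteq> {}" using U_ne F D by auto
  \<comment> \<open>A countable cofinal family in \<open>A\<close>, made increasing by taking running maxima.\<close>
  define d where "d = (\<lambda>n. Max (from_nat_into D ` {..n}))"
  have dA: "d n \<in> A" for n
  proof -
    have "d n \<in> from_nat_into D ` {..n}"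
      unfolding d_def by (intro Max_in) auto
    then show ?thesis using from_nat_into[OF Dne] D(1) by auto
  qed
  have d_mono: "d m \<le> d n" if "m \<le> n" for m n
    unfolding d_def by (rule Max_mono) (use that in auto)
  have U_d: "U = (\<Union>n. {..<d n})"
  proof -
    have "x \<in> (\<Union>n. {..<d n})" if "x < a" "a \<in> D" for x a
    proof -
      obtain n where "from_nat_into D n = a"
        using from_nat_into_surj D(2) \<open>a \<in> D\<close> by metis
      then have "a \<le> d n" unfolding d_def by (intro Max_ge) auto
      then show ?thesis using \<open>x < a\<close> by (auto intro: less_le_trans)
    qed
    moreover have "U = (\<Union>a\<in>D. {..<a})" using F D by simp
    moreover have "(\<Union>n. {..<d n}) \<subseteq> U" using dA by (auto simp: U_def)
    ultimately show ?thesis by blast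
  qed
  have one: "\<exists>s. A - U \<subseteq> {s}"
  proof -
    have "x = y" if "x \<in> A - U" "y \<in> A - U" for x y
      using that unfolding U_def by (cases x y rule: linorder_cases) auto
    then show ?thesis by blast
  qed
  then obtain s where s: "A - U \<subseteq> {s}" by blast
  have "A = (A \<inter> U) \<union> (A - U)" by blast
  then have "emeasure lborel A \<le> emeasure lborel (A \<inter> U) + emeasure lborel {s}"
    using s A by (intro order_trans[OF emeasure_mono[of A "(A \<inter> U) \<union> {s}" lborel]]
        emeasure_subadditive) (auto simp: U_d)
  also have "\<dots> = emeasure lborel (\<Union>n. A \<inter> {..<d n})"
    by (simp add: U_d)
  also have "\<dots> = (SUP n. emeasure lborel (A \<inter> {..<d n}))"
    using A d_mono by (intro SUP_emeasure_incseq[symmetric])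
       (auto simp: incseq_def, meson less_le_trans)
  also have "\<dots> \<le> (SUP a\<in>A. emeasure lborel (A \<inter> {..<a}))"
    by (intro SUP_least SUP_upper dA)
  finally show "emeasure lborel A \<le> (SUP a\<in>A. emeasure lborel (A \<inter> {..<a}))" .
qed (use A in \<open>auto intro!: SUP_least emeasure_mono\<close>)

lemma emeasure_lborel_affine_vimage:
  fixes S :: "real set"
  assumes "S \<in> sets borel" "0 < c"
  shows "emeasure lborel S = ennreal c * emeasure lborel ((\<lambda>x. t + c * x) -` S)"
proof -
  have [measurable]: "(\<lambda>x. t + c * x) -` S \<in> sets borel"
    using measurable_sets[of "\<lambda>x. t + c * x" borel borel S] assms by simp
  have "emeasure lborel S = (\<integral>\<^sup>+x. indicator S x \<partial>lborel)"
    using assms by simp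
  also have "\<dots> = ennreal \<bar>c\<bar> * (\<integral>\<^sup>+x. indicator S (t + c * x) \<partial>lborel)"
    using assms by (intro nn_integral_real_affine) auto
  also have "(\<lambda>x. indicator S (t + c * x) :: ennreal) = indicator ((\<lambda>x. t + c * x) -` S)"
    by (auto simp: indicator_def)
  finally show ?thesis using assms by simp
qed

lemma emeasure_lborel_uminus_vimage:
  fixes S :: "real set"
  assumes "S \<in> sets borel"
  shows "emeasure lborel (uminus -` S) = emeasure lborel S"
proof -
  have [measurable]: "uminus -` S \<in> sets borel"
    using measurable_sets[of uminus borel borel S] assms by simp
  have "emeasure lborel S = (\<integral>\<^sup>+x. indicator S x \<partial>lborel)"
    using assms by simp
  also have "\<dots> = ennreal \<bar>-1\<bar> * (\<integral>\<^sup>+x. indicator S (0 + (-1) * x) \<partial>lborel)"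
    using assms by (intro nn_integral_real_affine) auto
  also have "(\<lambda>x. indicator S (0 + (-1) * x) :: ennreal) = indicator (uminus -` S)"
    by (auto simp: indicator_def)
  finally show ?thesis using assms by simp
qed

lemma emeasure_eq_SUP_greaterThan:
  fixes A :: "real set"
  assumes A: "A \<in> sets borel" and ne: "A \<noteq> {}"
  shows "emeasure lborel A = (SUP a\<in>A. emeasure lborel (A \<inter> {a<..}))"
proof -
  have m: "uminus -` A \<in> sets borel"
    using measurable_sets[of uminus borel borel A] A by simp
  have "emeasure lborel A = emeasure lborel (uminus -` A)"
    using A by (simp add: emeasure_lborel_uminus_vimage)
  also have "\<dots> = (SUP a\<in>uminus -` A. emeasure lborel (uminus -` A \<inter> {..<a}))"
    using m ne by (intro emeasure_eq_SUP_lessThan) (auto simp: vimage_def, metis minus_minus)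
  also have "\<dots> = (SUP a\<in>uminus ` A. emeasure lborel (uminus -` A \<inter> {..<a}))"
    by (intro arg_cong[where f=Sup] image_cong) (auto simp: image_iff, metis minus_minus)
  also have "\<dots> = (SUP a\<in>A. emeasure lborel (uminus -` (A \<inter> {a<..})))"
    unfolding image_image
    by (intro arg_cong[where f=Sup] image_cong arg_cong2[where f=emeasure]) auto
  also have "\<dots> = (SUP a\<in>A. emeasure lborel (A \<inter> {a<..}))"
    using A by (intro arg_cong[where f=Sup] image_cong) (auto simp: emeasure_lborel_uminus_vimage simp del: vimage_Int)
  finally show ?thesis .
qed

text \<open>Fix \<open>a \<in> A\<close> and \<open>b \<in> B\<close>. The points of \<open>A\<close> below \<open>a\<close> combined with \<open>b\<close>, and \<open>a\<close> combined with the points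
of \<open>B\<close> above \<open>b\<close>, give two subsets of \<open>S\<close> separated by \<open>(1 - l) * a + l * b\<close>. Taking suprema over
\<open>a\<close> and \<open>b\<close> recovers the full measures.\<close>
lemma brunn_minkowski_real:
  fixes A B S :: "real set"
  assumes l: "0 < l" "l < 1" and [measurable]: "A \<in> sets borel" "B \<in> sets borel" "S \<in> sets borel"
    and ne: "A \<noteq> {}" "B \<noteq> {}"
    and S: "\<And>a b. a \<in> A \<Longrightarrow> b \<in> B \<Longrightarrow> (1 - l) * a + l * b \<in> S"
  shows "ennreal (1 - l) * emeasure lborel A + ennreal l * emeasure lborel B \<le> emeasure lborel S"
proof -
  have *: "ennreal (1 - l) * emeasure lborel (A \<inter> {..<a}) + ennreal l * emeasure lborel (B \<inter> {b<..})
           \<le> emeasure lborel S" if "a \<in> A" "b \<in> B" for a b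
  proof -
    \<comment> \<open>The point at which the two parts of \<open>S\<close> are separated.\<close>
    let ?c = "(1 - l) * a + l * b"
    have m: "(\<lambda>x. t + c * x) -` T \<in> sets lborel" if "T \<in> sets borel" for T and t c :: real
      using measurable_sets[of "\<lambda>x. t + c * x" borel borel T] that by simp
    have "ennreal (1 - l) * emeasure lborel (A \<inter> {..<a})
        \<le> ennreal (1 - l) * emeasure lborel ((\<lambda>x. l * b + (1 - l) * x) -` (S \<inter> {..<?c}))"
    proof (intro mult_left_mono emeasure_mono m subsetI)
      fix x assume x: "x \<in> A \<inter> {..<a}"
      then show "x \<in> (\<lambda>x. l * b + (1 - l) * x) -` (S \<inter> {..<?c})"
        using S[of x b] l \<open>b \<in> B\<close> by (auto simp: add.commute)
    qed auto
    also have "\<dots> = emeasure lborel (S \<inter> {..<?c})"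
      using l by (intro emeasure_lborel_affine_vimage[symmetric]) auto
    finally have 1: "ennreal (1 - l) * emeasure lborel (A \<inter> {..<a}) \<le> emeasure lborel (S \<inter> {..<?c})" .
    have "ennreal l * emeasure lborel (B \<inter> {b<..})
        \<le> ennreal l * emeasure lborel ((\<lambda>x. (1 - l) * a + l * x) -` (S \<inter> {?c<..}))"
    proof (intro mult_left_mono emeasure_mono m subsetI)
      fix x assume x: "x \<in> B \<inter> {b<..}"
      then show "x \<in> (\<lambda>x. (1 - l) * a + l * x) -` (S \<inter> {?c<..})"
        using S[of a x] l \<open>a \<in> A\<close> by auto
    qed auto
    also have "\<dots> = emeasure lborel (S \<inter> {?c<..})"
      using l by (intro emeasure_lborel_affine_vimage[symmetric]) auto
    finally have 2: "ennreal l * emeasure lborel (B \<inter> {b<..}) \<le> emeasure lborel (S \<inter> {?c<..})" .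
    have "emeasure lborel (S \<inter> {..<?c}) + emeasure lborel (S \<inter> {?c<..})
        = emeasure lborel ((S \<inter> {..<?c}) \<union> (S \<inter> {?c<..}))"
      by (intro plus_emeasure) auto
    also have "\<dots> \<le> emeasure lborel S" by (intro emeasure_mono) auto
    finally show ?thesis using add_mono[OF 1 2] by (rule order_trans[rotated])
  qed
  have "ennreal (1 - l) * emeasure lborel A + ennreal l * emeasure lborel B
      = (SUP b\<in>B. SUP a\<in>A. ennreal (1 - l) * emeasure lborel (A \<inter> {..<a})
                + ennreal l * emeasure lborel (B \<inter> {b<..}))"
    using ne
    by (subst emeasure_eq_SUP_lessThan[of A], simp, simp,
        subst emeasure_eq_SUP_greaterThan[of B], simp, simp)
       (simp add: SUP_mult_left_ennreal ennreal_SUP_add_left ennreal_SUP_add_right)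
  also have "\<dots> \<le> emeasure lborel S"
    using * by (intro SUP_least) auto
  finally show ?thesis .
qed

text \<open>The layer cake formula at a single point, with levels measured as fractions \<open>\<tau>\<close> of an upper bound \<open>a\<close>;
this scaling lets functions with different suprema be compared level by level.\<close>
lemma ennreal_layer_cake:
  fixes v :: ennreal
  assumes "v \<le> ennreal a" "0 < a"
  shows "v = ennreal a * (\<integral>\<^sup>+\<tau>. indicator {\<tau>. 0 < \<tau> \<and> \<tau> < 1 \<and> ennreal (\<tau> * a) < v} \<tau> \<partial>lborel)"
proof -
  obtain r where r: "v = ennreal r" "0 \<le> r" "r \<le> a"
    using assms by (cases v) (auto simp: top_unique)
  have "{\<tau>. 0 < \<tau> \<and> \<tau> < 1 \<and> ennreal (\<tau> * a) < v} = {0<..<r / a}"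
    using r assms(2) by (auto simp: ennreal_less_iff pos_less_divide_eq)
       (smt (verit) divide_le_eq_1 pos_less_divide_eq)
  then show ?thesis using r assms
    by (simp add: ennreal_mult[symmetric])
qed

lemma ennreal_layer_cake_le:
  fixes v :: ennreal
  assumes "0 < a"
  shows "ennreal a * (\<integral>\<^sup>+\<tau>. indicator {\<tau>. 0 < \<tau> \<and> \<tau> < 1 \<and> ennreal (\<tau> * a) \<le> v} \<tau> \<partial>lborel) \<le> v"
proof (cases v)
  case (real r)
  have "ennreal a * (\<integral>\<^sup>+\<tau>. indicator {\<tau>. 0 < \<tau> \<and> \<tau> < 1 \<and> ennreal (\<tau> * a) \<le> v} \<tau> \<partial>lborel)
      \<le> ennreal a * (\<integral>\<^sup>+\<tau>. indicator {0..r / a} \<tau> \<partial>lborel)"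
    using real assms
    by (intro mult_left_mono nn_integral_mono)
       (auto simp: indicator_def pos_le_divide_eq)
  also have "\<dots> = v" using real assms by (simp add: ennreal_mult[symmetric])
  finally show ?thesis .
qed simp

text \<open>Brunn-Minkowski applied to the level sets at the relative level \<open>\<tau>\<close>, integrated over \<open>\<tau>\<close> between 0 and
1. That \<open>a\<close> and \<open>b\<close> are the exact suprema makes both level sets nonempty for every such \<open>\<tau>\<close>.\<close>
lemma nn_integral_level_sets:
  fixes f g h :: "real \<Rightarrow> ennreal"
  assumes l: "0 < l" "l < 1" and pos: "0 < a" "0 < b" "0 < M"
    and [measurable]: "f \<in> borel_measurable borel" "g \<in> borel_measurable borel" "h \<in> borel_measurable borel"
    and fa: "\<And>x. f x \<le> ennreal a" "\<And>\<tau>. \<tau> < 1 \<Longrightarrow> \<exists>x. ennreal (\<tau> * a) < f x"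
    and gb: "\<And>x. g x \<le> ennreal b" "\<And>\<tau>. \<tau> < 1 \<Longrightarrow> \<exists>x. ennreal (\<tau> * b) < g x"
    and h: "\<And>x y \<tau>. 0 < \<tau> \<Longrightarrow> \<tau> < 1 \<Longrightarrow> ennreal (\<tau> * a) < f x \<Longrightarrow> ennreal (\<tau> * b) < g y
      \<Longrightarrow> ennreal (\<tau> * M) \<le> h ((1 - l) * x + l * y)"
  shows "ennreal M * (ennreal ((1 - l) / a) * (\<integral>\<^sup>+x. f x \<partial>lborel) + ennreal (l / b) * (\<integral>\<^sup>+x. g x \<partial>lborel))
    \<le> (\<integral>\<^sup>+x. h x \<partial>lborel)"
proof -
  define F where "F = (\<lambda>\<tau>. emeasure lborel {x. 0 < \<tau> \<and> \<tau> < 1 \<and> ennreal (\<tau> * a) < f x})"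
  define G where "G = (\<lambda>\<tau>. emeasure lborel {x. 0 < \<tau> \<and> \<tau> < 1 \<and> ennreal (\<tau> * b) < g x})"
  define H where "H = (\<lambda>\<tau>. emeasure lborel {x. 0 < \<tau> \<and> \<tau> < 1 \<and> ennreal (\<tau> * M) \<le> h x})"
  have Fubini: "(\<integral>\<^sup>+x. (\<integral>\<^sup>+\<tau>. indicator {\<tau>. P \<tau> x} \<tau> \<partial>lborel) \<partial>lborel)
      = (\<integral>\<^sup>+\<tau>. emeasure lborel {x. P \<tau> x} \<partial>lborel)"
    if [measurable]: "Measurable.pred (borel \<Otimes>\<^sub>M borel) (\<lambda>(\<tau>, x). P \<tau> x)"
    for P :: "real \<Rightarrow> real \<Rightarrow> bool"
  proof -
    have m: "Measurable.pred (lborel \<Otimes>\<^sub>M lborel) (\<lambda>(\<tau>, x). P \<tau> x)"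
      using that by (simp add: measurable_cong_sets[OF sets_pair_measure_cong[OF sets_lborel sets_lborel] refl])
    have "(\<integral>\<^sup>+x. (\<integral>\<^sup>+\<tau>. indicator {\<tau>. P \<tau> x} \<tau> \<partial>lborel) \<partial>lborel)
        = (\<integral>\<^sup>+x. (\<integral>\<^sup>+\<tau>. (if P \<tau> x then 1 else 0) \<partial>lborel) \<partial>lborel)"
      by (intro nn_integral_cong) (simp add: indicator_def)
    also have "\<dots> = (\<integral>\<^sup>+\<tau>. (\<integral>\<^sup>+x. (if P \<tau> x then 1 else 0) \<partial>lborel) \<partial>lborel)"
      using m by (intro lborel_pair.Fubini') (simp add: case_prod_beta')
    also have "\<dots> = (\<integral>\<^sup>+\<tau>. (\<integral>\<^sup>+x. indicator {x. P \<tau> x} x \<partial>lborel) \<partial>lborel)"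
      by (intro nn_integral_cong) (simp add: indicator_def)
    also have "\<dots> = (\<integral>\<^sup>+\<tau>. emeasure lborel {x. P \<tau> x} \<partial>lborel)"
      by (intro nn_integral_cong nn_integral_indicator) simp
    finally show ?thesis .
  qed
  have [measurable]: "F \<in> borel_measurable borel" "G \<in> borel_measurable borel" "H \<in> borel_measurable borel"
    unfolding F_def G_def H_def by measurable
  have intf: "(\<integral>\<^sup>+x. f x \<partial>lborel) = ennreal a * (\<integral>\<^sup>+\<tau>. F \<tau> \<partial>lborel)"
  proof -
    have "(\<integral>\<^sup>+x. f x \<partial>lborel) = (\<integral>\<^sup>+x. ennreal a *
        (\<integral>\<^sup>+\<tau>. indicator {\<tau>. 0 < \<tau> \<and> \<tau> < 1 \<and> ennreal (\<tau> * a) < f x} \<tau> \<partial>lborel) \<partial>lborel)"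
      using pos fa by (intro nn_integral_cong ennreal_layer_cake)
    also have "\<dots> = ennreal a * (\<integral>\<^sup>+\<tau>. F \<tau> \<partial>lborel)"
      unfolding F_def by (subst nn_integral_cmult, measurable) (subst Fubini, measurable)
    finally show ?thesis .
  qed
  have intg: "(\<integral>\<^sup>+x. g x \<partial>lborel) = ennreal b * (\<integral>\<^sup>+\<tau>. G \<tau> \<partial>lborel)"
  proof -
    have "(\<integral>\<^sup>+x. g x \<partial>lborel) = (\<integral>\<^sup>+x. ennreal b *
        (\<integral>\<^sup>+\<tau>. indicator {\<tau>. 0 < \<tau> \<and> \<tau> < 1 \<and> ennreal (\<tau> * b) < g x} \<tau> \<partial>lborel) \<partial>lborel)"
      using pos gb by (intro nn_integral_cong ennreal_layer_cake)
    also have "\<dots> = ennreal b * (\<integral>\<^sup>+\<tau>. G \<tau> \<partial>lborel)"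
      unfolding G_def by (subst nn_integral_cmult, measurable) (subst Fubini, measurable)
    finally show ?thesis .
  qed
  have inth: "ennreal M * (\<integral>\<^sup>+\<tau>. H \<tau> \<partial>lborel) \<le> (\<integral>\<^sup>+x. h x \<partial>lborel)"
  proof -
    have "ennreal M * (\<integral>\<^sup>+\<tau>. H \<tau> \<partial>lborel) = (\<integral>\<^sup>+x. ennreal M *
        (\<integral>\<^sup>+\<tau>. indicator {\<tau>. 0 < \<tau> \<and> \<tau> < 1 \<and> ennreal (\<tau> * M) \<le> h x} \<tau> \<partial>lborel) \<partial>lborel)"
      unfolding H_def by (subst nn_integral_cmult, measurable) (subst Fubini, measurable)
    also have "\<dots> \<le> (\<integral>\<^sup>+x. h x \<partial>lborel)"
      using pos by (intro nn_integral_mono ennreal_layer_cake_le)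
    finally show ?thesis .
  qed
  have lev: "ennreal (1 - l) * F \<tau> + ennreal l * G \<tau> \<le> H \<tau>" for \<tau>
  proof (cases "0 < \<tau> \<and> \<tau> < 1")
    case True
    then show ?thesis
      unfolding F_def G_def H_def using l fa(2)[of \<tau>] gb(2)[of \<tau>] h[of \<tau>]
      by (intro brunn_minkowski_real) auto
  qed (auto simp: F_def G_def H_def)
  have "ennreal ((1 - l) / a) * (\<integral>\<^sup>+x. f x \<partial>lborel) + ennreal (l / b) * (\<integral>\<^sup>+x. g x \<partial>lborel)
      = ennreal (1 - l) * (\<integral>\<^sup>+\<tau>. F \<tau> \<partial>lborel) + ennreal l * (\<integral>\<^sup>+\<tau>. G \<tau> \<partial>lborel)"
    unfolding intf intg using l pos by (simp add: mult.assoc[symmetric] ennreal_mult[symmetric])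
  also have "\<dots> = (\<integral>\<^sup>+\<tau>. ennreal (1 - l) * F \<tau> + ennreal l * G \<tau> \<partial>lborel)"
    by (simp add: nn_integral_add nn_integral_cmult)
  also have "\<dots> \<le> (\<integral>\<^sup>+\<tau>. H \<tau> \<partial>lborel)" by (intro nn_integral_mono lev)
  finally show ?thesis using inth by (meson mult_left_mono order_trans zero_le)
qed

text \<open>The relation \<open>m a b \<le> c\<close> for a mean \<open>m\<close> of finite positive numbers and extended \<open>a\<close> and \<open>b\<close>: only
numbers strictly below \<open>a\<close> and \<open>b\<close> are inserted, so that infinite values are approached from below.
The relation holds trivially if \<open>a\<close> or \<open>b\<close> vanishes, as the functional inequalities below require.\<close>
definition mean_dom :: "(real \<Rightarrow> real \<Rightarrow> real) \<Rightarrow> ennreal \<Rightarrow> ennreal \<Rightarrow> ennreal \<Rightarrow> bool" where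
  "mean_dom m a b c \<longleftrightarrow>
     (\<forall>\<alpha>>0. \<forall>\<beta>>0. ennreal \<alpha> < a \<longrightarrow> ennreal \<beta> < b \<longrightarrow> ennreal (m \<alpha> \<beta>) \<le> c)"

lemma mean_domD: "mean_dom m a b c \<Longrightarrow> 0 < \<alpha> \<Longrightarrow> 0 < \<beta> \<Longrightarrow> ennreal \<alpha> < a \<Longrightarrow> ennreal \<beta> < b
    \<Longrightarrow> ennreal (m \<alpha> \<beta>) \<le> c"
  by (auto simp: mean_dom_def)

lemma nn_integral_truncate:
  assumes [measurable]: "f \<in> borel_measurable M" and "\<alpha> < (\<integral>\<^sup>+x. f x \<partial>M)"
  obtains k :: nat where "0 < k" "\<alpha> < (\<integral>\<^sup>+x. min (f x) (of_nat k) \<partial>M)"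
proof -
  have sup: "(SUP k. min (f x) (of_nat k)) = f x" for x
  proof -
    have "(SUP k. min (f x) (of_nat k :: ennreal)) = min (f x) (SUP k. of_nat k)"
      by (simp add: min_def[symmetric] inf_min[symmetric] inf_SUP)
    then show ?thesis by (simp add: ennreal_SUP_of_nat_eq_top)
  qed
  have "(\<integral>\<^sup>+x. f x \<partial>M) = (\<integral>\<^sup>+x. (SUP k. min (f x) (of_nat k)) \<partial>M)"
    by (simp add: sup)
  also have "\<dots> = (SUP k. \<integral>\<^sup>+x. min (f x) (of_nat k) \<partial>M)"
    by (intro nn_integral_monotone_convergence_SUP)
       (auto simp: incseq_def le_fun_def intro: min.coboundedI2 of_nat_mono)
  finally obtain k where k: "\<alpha> < (\<integral>\<^sup>+x. min (f x) (of_nat k) \<partial>M)"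
    using assms(2) by (auto simp: less_SUP_iff)
  have "k \<noteq> 0" using k by (auto intro: ccontr)
  then show ?thesis using that k by blast
qed

text \<open>The pointwise supremum rather than the essential one: all that level sets below it have to be is nonempty.\<close>
lemma tight_bound:
  fixes f :: "real \<Rightarrow> ennreal"
  assumes "\<And>x. f x \<le> of_nat k" "(\<integral>\<^sup>+x. f x \<partial>M) \<noteq> 0"
  obtains a where "0 < a" "\<And>x. f x \<le> ennreal a" "\<And>\<tau>. \<tau> < 1 \<Longrightarrow> \<exists>x. ennreal (\<tau> * a) < f x"
proof -
  have "(SUP x. f x) \<le> of_nat k" using assms by (intro SUP_least)
  then obtain a where a: "(SUP x. f x) = ennreal a" "0 \<le> a"
    by (cases "SUP x. f x") (auto simp: top_unique)
  have le: "f x \<le> ennreal a" for x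
    using SUP_upper[of x UNIV f] a by simp
  have "a \<noteq> 0"
  proof
    assume "a = 0"
    then have "f x = 0" for x using le[of x] by simp
    then show False using assms(2) by simp
  qed
  then have a0: "0 < a" using a by simp
  have "\<exists>x. ennreal (\<tau> * a) < f x" if "\<tau> < 1" for \<tau>
  proof -
    have "ennreal (\<tau> * a) < (SUP x. f x)"
      unfolding a using mult_strict_right_mono[OF that a0] a0 by (intro ennreal_lessI) auto
    then show ?thesis by (auto simp: less_SUP_iff)
  qed
  then show ?thesis using that a0 le by blast
qed

text \<open>The common core of the one-dimensional Prekopa-Leindler and Borell-Brascamp-Lieb inequalities. After
truncation both functions have finite suprema \<open>a\<close> and \<open>b\<close>; homogeneity of \<open>m\<close> turns the pointwise
hypothesis into an inclusion between relative level sets, so \<open>\<integral>h\<close> is at least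
\<open>m a b * ((1 - l) * (\<integral>f / a) + l * (\<integral>g / b))\<close>, and the assumed Hoelder-type inequality removes the
suprema.\<close>
lemma mean_dom_nn_integral:
  fixes f g h :: "real \<Rightarrow> ennreal"
  assumes l: "0 < l" "l < 1"
    and [measurable]: "f \<in> borel_measurable borel" "g \<in> borel_measurable borel" "h \<in> borel_measurable borel"
    and pos: "\<And>a b. 0 < a \<Longrightarrow> 0 < b \<Longrightarrow> 0 < m a b"
    and hom: "\<And>a b \<tau>. 0 < a \<Longrightarrow> 0 < b \<Longrightarrow> 0 < \<tau> \<Longrightarrow> m (\<tau> * a) (\<tau> * b) = \<tau> * m a b"
    and hoelder: "\<And>a b \<alpha> \<beta>. 0 < a \<Longrightarrow> 0 < b \<Longrightarrow> 0 < \<alpha> \<Longrightarrow> 0 < \<beta> \<Longrightarrow>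
        m' \<alpha> \<beta> \<le> m a b * ((1 - l) * (\<alpha> / a) + l * (\<beta> / b))"
    and dom: "\<And>x y. mean_dom m (f x) (g y) (h ((1 - l) * x + l * y))"
  shows "mean_dom m' (\<integral>\<^sup>+x. f x \<partial>lborel) (\<integral>\<^sup>+x. g x \<partial>lborel) (\<integral>\<^sup>+x. h x \<partial>lborel)"
  unfolding mean_dom_def
proof (intro allI impI)
  fix \<alpha> \<beta> :: real
  assume \<alpha>: "0 < \<alpha>" "ennreal \<alpha> < (\<integral>\<^sup>+x. f x \<partial>lborel)"
    and \<beta>: "0 < \<beta>" "ennreal \<beta> < (\<integral>\<^sup>+x. g x \<partial>lborel)"
  obtain j :: nat where j: "0 < j" "ennreal \<alpha> < (\<integral>\<^sup>+x. min (f x) (of_nat j) \<partial>lborel)"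
    using nn_integral_truncate[OF _ \<alpha>(2)] by auto
  obtain k :: nat where k: "0 < k" "ennreal \<beta> < (\<integral>\<^sup>+x. min (g x) (of_nat k) \<partial>lborel)"
    using nn_integral_truncate[OF _ \<beta>(2)] by auto
  define f' where "f' = (\<lambda>x. min (f x) (of_nat j))"
  define g' where "g' = (\<lambda>x. min (g x) (of_nat k))"
  have [measurable]: "f' \<in> borel_measurable borel" "g' \<in> borel_measurable borel"
    unfolding f'_def g'_def by measurable
  obtain a where a: "0 < a" "\<And>x. f' x \<le> ennreal a" "\<And>\<tau>. \<tau> < 1 \<Longrightarrow> \<exists>x. ennreal (\<tau> * a) < f' x"
    using j by (elim tight_bound[of f' j lborel, rotated 2]) (auto simp: f'_def)
  obtain b where b: "0 < b" "\<And>x. g' x \<le> ennreal b" "\<And>\<tau>. \<tau> < 1 \<Longrightarrow> \<exists>x. ennreal (\<tau> * b) < g' x"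
    using k by (elim tight_bound[of g' k lborel, rotated 2]) (auto simp: g'_def)
  have "ennreal (m' \<alpha> \<beta>) \<le> ennreal (m a b * ((1 - l) * (\<alpha> / a) + l * (\<beta> / b)))"
    using hoelder[of a b \<alpha> \<beta>] a b \<alpha> \<beta> by (intro ennreal_leI) auto
  also have "\<dots> = ennreal (m a b) * (ennreal ((1 - l) / a) * ennreal \<alpha> + ennreal (l / b) * ennreal \<beta>)"
    using l a(1) b(1) \<alpha>(1) \<beta>(1) pos[of a b]
    by (simp add: ennreal_mult[symmetric] ennreal_plus[symmetric] del: ennreal_plus)
  also have "\<dots> \<le> ennreal (m a b) * (ennreal ((1 - l) / a) * (\<integral>\<^sup>+x. f' x \<partial>lborel)
      + ennreal (l / b) * (\<integral>\<^sup>+x. g' x \<partial>lborel))"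
    using j k by (intro mult_left_mono add_mono) (auto simp: f'_def g'_def intro: less_imp_le)
  also have "\<dots> \<le> (\<integral>\<^sup>+x. h x \<partial>lborel)"
  proof (rule nn_integral_level_sets[OF l a(1) b(1) pos[OF a(1) b(1)] _ _ _ a(2) a(3) b(2) b(3)])
    fix x y \<tau> assume "0 < \<tau>" "\<tau> < 1" "ennreal (\<tau> * a) < f' x" "ennreal (\<tau> * b) < g' y"
    then show "ennreal (\<tau> * m a b) \<le> h ((1 - l) * x + l * y)"
      using mean_domD[OF dom[of x y], of "\<tau> * a" "\<tau> * b"] hom[of a b \<tau>] a(1) b(1)
      by (auto simp: f'_def g'_def)
  qed auto
  finally show "ennreal (m' \<alpha> \<beta>) \<le> (\<integral>\<^sup>+x. h x \<partial>lborel)" .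
qed

section \<open>The Prekopa-Leindler inequality\<close>

definition geometric_mean :: "real \<Rightarrow> real \<Rightarrow> real \<Rightarrow> real" where
  "geometric_mean t a b = a powr (1 - t) * b powr t"

lemma geometric_mean_le_arithmetic_mean:
  assumes "0 < t" "t < 1" "0 < a" "0 < b"
  shows "geometric_mean t a b \<le> (1 - t) * a + t * b"
  using Youngs_inequality_0[of "1 - t" t a b] assms by (simp add: geometric_mean_def)

lemma geometric_mean_pos: "0 < a \<Longrightarrow> 0 < b \<Longrightarrow> 0 < geometric_mean t a b"
  by (simp add: geometric_mean_def)

lemma geometric_mean_mult:
  assumes "0 < a" "0 < b" "0 < c" "0 < d"
  shows "geometric_mean t (a * c) (b * d) = geometric_mean t a b * geometric_mean t c d"
  using assms by (simp add: geometric_mean_def powr_mult)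

lemma geometric_mean_refl: "0 < a \<Longrightarrow> geometric_mean t a a = a"
  by (simp add: geometric_mean_def powr_add[symmetric])

lemma prekopa_leindler_real:
  fixes f g h :: "real \<Rightarrow> ennreal"
  assumes t: "0 < t" "t < 1"
    and meas: "f \<in> borel_measurable borel" "g \<in> borel_measurable borel" "h \<in> borel_measurable borel"
    and dom: "\<And>x y. mean_dom (geometric_mean t) (f x) (g y) (h ((1 - t) * x + t * y))"
  shows "mean_dom (geometric_mean t) (\<integral>\<^sup>+x. f x \<partial>lborel) (\<integral>\<^sup>+x. g x \<partial>lborel) (\<integral>\<^sup>+x. h x \<partial>lborel)"
proof (rule mean_dom_nn_integral[OF t meas _ _ _ dom])
  fix a b \<alpha> \<beta> :: real assume pos: "0 < a" "0 < b" "0 < \<alpha>" "0 < \<beta>"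
  have "geometric_mean t \<alpha> \<beta> = geometric_mean t (a * (\<alpha> / a)) (b * (\<beta> / b))"
    using pos by simp
  also have "\<dots> = geometric_mean t a b * geometric_mean t (\<alpha> / a) (\<beta> / b)"
    using pos by (intro geometric_mean_mult) auto
  also have "\<dots> \<le> geometric_mean t a b * ((1 - t) * (\<alpha> / a) + t * (\<beta> / b))"
    using pos t geometric_mean_pos[of a b t]
    by (intro mult_left_mono geometric_mean_le_arithmetic_mean) auto
  finally show "geometric_mean t \<alpha> \<beta> \<le> geometric_mean t a b * ((1 - t) * (\<alpha> / a) + t * (\<beta> / b))" .
qed (auto simp: geometric_mean_pos geometric_mean_mult geometric_mean_refl)

text \<open>Induction on the number of coordinates: integrating out one coordinate preserves the hypothesis by the
one-dimensional case.\<close>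
lemma prekopa_leindler_PiM:
  fixes f g h :: "('i \<Rightarrow> real) \<Rightarrow> ennreal"
  assumes t: "0 < t" "t < 1" and "finite I"
    and "f \<in> borel_measurable (Pi\<^sub>M I (\<lambda>_. lborel))" "g \<in> borel_measurable (Pi\<^sub>M I (\<lambda>_. lborel))"
      "h \<in> borel_measurable (Pi\<^sub>M I (\<lambda>_. lborel))"
    and "\<And>x y. x \<in> space (Pi\<^sub>M I (\<lambda>_. lborel)) \<Longrightarrow> y \<in> space (Pi\<^sub>M I (\<lambda>_. lborel)) \<Longrightarrow>
      mean_dom (geometric_mean t) (f x) (g y) (h (\<lambda>i. (1 - t) * x i + t * y i))"
  shows "mean_dom (geometric_mean t) (\<integral>\<^sup>+x. f x \<partial>Pi\<^sub>M I (\<lambda>_. lborel))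
    (\<integral>\<^sup>+x. g x \<partial>Pi\<^sub>M I (\<lambda>_. lborel)) (\<integral>\<^sup>+x. h x \<partial>Pi\<^sub>M I (\<lambda>_. lborel))"
  using assms(3-)
proof (induction I arbitrary: f g h)
  case empty
  interpret product_sigma_finite "\<lambda>_. lborel :: real measure" by standard
  \<comment> \<open>Outside the index set coordinates are \<open>undefined\<close>, which affine combinations preserve.\<close>
  have "(1 - t) * u + t * u = u" for u :: real by (simp add: algebra_simps)
  then show ?case
    using empty.prems(4)[of "\<lambda>_. undefined" "\<lambda>_. undefined"] by (simp add: nn_integral_empty)
next
  case (insert i I)
  note [measurable] = insert.prems(1-3)
  interpret product_sigma_finite "\<lambda>_. lborel :: real measure" by standard
  have upd: "(\<lambda>j. (1 - t) * (x(i := r)) j + t * (y(i := s)) j)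
      = (\<lambda>j. (1 - t) * x j + t * y j)(i := (1 - t) * r + t * s)" for x y and r s :: real
    by auto
  have slice: "(\<lambda>r. u (x(i := r))) \<in> borel_measurable borel"
    if "u \<in> borel_measurable (Pi\<^sub>M (insert i I) (\<lambda>_. lborel))" "x \<in> space (Pi\<^sub>M I (\<lambda>_. lborel))"
    for u :: "('i \<Rightarrow> real) \<Rightarrow> ennreal" and x
    using measurable_comp[OF measurable_component_update[OF that(2) insert.hyps(2)] that(1)]
    by (simp add: comp_def)
  let ?P = "Pi\<^sub>M I (\<lambda>_. lborel :: real measure)"
  have "mean_dom (geometric_mean t) (\<integral>\<^sup>+r. f (x(i := r)) \<partial>lborel) (\<integral>\<^sup>+r. g (y(i := r)) \<partial>lborel)
     (\<integral>\<^sup>+r. h ((\<lambda>j. (1 - t) * x j + t * y j)(i := r)) \<partial>lborel)"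
    if xy: "x \<in> space ?P" "y \<in> space ?P" for x y
  proof (rule prekopa_leindler_real[OF t])
    have "(1 - t) * u + t * u = u" for u :: real by (simp add: algebra_simps)
    then have "(\<lambda>j. (1 - t) * x j + t * y j) \<in> space ?P"
      using xy by (auto simp: space_PiM PiE_def extensional_def)
    then show "(\<lambda>r. f (x(i := r))) \<in> borel_measurable borel" "(\<lambda>r. g (y(i := r))) \<in> borel_measurable borel"
      "(\<lambda>r. h ((\<lambda>j. (1 - t) * x j + t * y j)(i := r))) \<in> borel_measurable borel"
      using xy by (auto intro!: slice insert.prems)
    show "mean_dom (geometric_mean t) (f (x(i := r))) (g (y(i := s)))
        (h ((\<lambda>j. (1 - t) * x j + t * y j)(i := (1 - t) * r + t * s)))" for r s
      unfolding upd[symmetric] using xy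
      by (intro insert.prems) (auto simp: space_PiM PiE_def extensional_def)
  qed
  moreover have "(\<lambda>x. \<integral>\<^sup>+r. u (x(i := r)) \<partial>lborel) \<in> borel_measurable ?P"
    if [measurable]: "u \<in> borel_measurable (Pi\<^sub>M (insert i I) (\<lambda>_. lborel))"
    for u :: "('i \<Rightarrow> real) \<Rightarrow> ennreal"
    by measurable
  ultimately have "mean_dom (geometric_mean t) (\<integral>\<^sup>+x. \<integral>\<^sup>+r. f (x(i := r)) \<partial>lborel \<partial>?P)
      (\<integral>\<^sup>+x. \<integral>\<^sup>+r. g (x(i := r)) \<partial>lborel \<partial>?P) (\<integral>\<^sup>+x. \<integral>\<^sup>+r. h (x(i := r)) \<partial>lborel \<partial>?P)"
    using insert.prems(1-3) by (intro insert.IH)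
  then show ?case
    by (simp only: product_nn_integral_insert[OF insert.hyps insert.prems(1)]
        product_nn_integral_insert[OF insert.hyps insert.prems(2)]
        product_nn_integral_insert[OF insert.hyps insert.prems(3)])
qed

theorem prekopa_leindler:
  fixes f g h :: "'a::euclidean_space \<Rightarrow> ennreal"
  assumes t: "0 < t" "t < 1"
    and [measurable]: "f \<in> borel_measurable borel" "g \<in> borel_measurable borel" "h \<in> borel_measurable borel"
    and dom: "\<And>x y. mean_dom (geometric_mean t) (f x) (g y) (h ((1 - t) *\<^sub>R x + t *\<^sub>R y))"
  shows "mean_dom (geometric_mean t) (\<integral>\<^sup>+x. f x \<partial>lborel) (\<integral>\<^sup>+x. g x \<partial>lborel) (\<integral>\<^sup>+x. h x \<partial>lborel)"
proof -
  let ?B = "\<lambda>x. \<Sum>b\<in>Basis. x b *\<^sub>R b :: 'a"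
  have [measurable]: "?B \<in> (\<Pi>\<^sub>M b\<in>Basis. lborel) \<rightarrow>\<^sub>M borel" by measurable
  have int: "(\<integral>\<^sup>+x. u x \<partial>lborel) = (\<integral>\<^sup>+x. u (?B x) \<partial>(\<Pi>\<^sub>M b\<in>Basis. lborel))"
    if [measurable]: "u \<in> borel_measurable borel" for u :: "'a \<Rightarrow> ennreal"
    by (subst lborel_eq) (simp add: nn_integral_distr)
  have lin: "?B (\<lambda>b. (1 - t) * x b + t * y b) = (1 - t) *\<^sub>R ?B x + t *\<^sub>R ?B y" for x y
    by (simp add: scaleR_add_left sum.distrib scaleR_sum_right)
  have "mean_dom (geometric_mean t) (\<integral>\<^sup>+x. f (?B x) \<partial>(\<Pi>\<^sub>M b\<in>Basis. lborel))
     (\<integral>\<^sup>+x. g (?B x) \<partial>(\<Pi>\<^sub>M b\<in>Basis. lborel)) (\<integral>\<^sup>+x. h (?B x) \<partial>(\<Pi>\<^sub>M b\<in>Basis. lborel))"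
    by (rule prekopa_leindler_PiM[OF t]) (use dom in \<open>simp_all only: lin finite_Basis, measurable\<close>)
  then show ?thesis by (simp add: int)
qed

section \<open>Harmonic means on the half-line\<close>

definition harmonic_mean :: "real \<Rightarrow> real \<Rightarrow> real \<Rightarrow> real" where
  "harmonic_mean l a b = inverse ((1 - l) / a + l / b)"

definition power_mean_minus_half :: "real \<Rightarrow> real \<Rightarrow> real \<Rightarrow> real" where
  "power_mean_minus_half l a b = inverse (((1 - l) / sqrt a + l / sqrt b)\<^sup>2)"

text \<open>The Cauchy-Schwarz inequality for two terms with weights \<open>1 - l\<close> and \<open>l\<close>.\<close>
lemma harmonic_mean_le_power_mean_mult:
  assumes l: "0 < l" "l < 1" and pos: "0 < a" "0 < b" "0 < \<alpha>" "0 < \<beta>"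
  shows "harmonic_mean l \<alpha> \<beta> \<le> power_mean_minus_half l a b * ((1 - l) * (\<alpha> / a) + l * (\<beta> / b))"
proof -
  define u where "u = sqrt \<alpha> / sqrt a"
  define v where "v = sqrt \<beta> / sqrt b"
  define p where "p = 1 / sqrt \<alpha>"
  define q where "q = 1 / sqrt \<beta>"
  have e: "\<alpha> / a = u\<^sup>2" "\<beta> / b = v\<^sup>2" "(1 - l) / \<alpha> + l / \<beta> = (1 - l) * p\<^sup>2 + l * q\<^sup>2"
    "(1 - l) / sqrt a + l / sqrt b = (1 - l) * (u * p) + l * (v * q)"
    using pos by (auto simp: u_def v_def p_def q_def power_divide)
  have pos': "0 < u" "0 < v" "0 < p" "0 < q" using pos by (auto simp: u_def v_def p_def q_def)
  have "((1 - l) * u\<^sup>2 + l * v\<^sup>2) * ((1 - l) * p\<^sup>2 + l * q\<^sup>2) - ((1 - l) * (u * p) + l * (v * q))\<^sup>2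
      = l * (1 - l) * (u * q - v * p)\<^sup>2"
    by algebra
  also have "\<dots> \<ge> 0" using l by simp
  finally have cs: "((1 - l) * (u * p) + l * (v * q))\<^sup>2 \<le> ((1 - l) * u\<^sup>2 + l * v\<^sup>2) * ((1 - l) * p\<^sup>2 + l * q\<^sup>2)"
    by simp
  have "0 < (1 - l) * (u * p) + l * (v * q)"
    using l pos' by (intro add_pos_pos mult_pos_pos) auto
  then have d: "0 < (1 - l) * p\<^sup>2 + l * q\<^sup>2" "0 < ((1 - l) * (u * p) + l * (v * q))\<^sup>2"
    using l pos' by (auto intro!: add_pos_pos)
  show ?thesis
    unfolding harmonic_mean_def power_mean_minus_half_def e
    using cs d by (simp add: field_simps)
qed

lemma borell_brascamp_lieb_real:
  fixes f g h :: "real \<Rightarrow> ennreal"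
  assumes l: "0 < l" "l < 1"
    and meas: "f \<in> borel_measurable borel" "g \<in> borel_measurable borel" "h \<in> borel_measurable borel"
    and dom: "\<And>x y. mean_dom (power_mean_minus_half l) (f x) (g y) (h ((1 - l) * x + l * y))"
  shows "mean_dom (harmonic_mean l) (\<integral>\<^sup>+x. f x \<partial>lborel) (\<integral>\<^sup>+x. g x \<partial>lborel) (\<integral>\<^sup>+x. h x \<partial>lborel)"
proof (rule mean_dom_nn_integral[OF l meas _ _ harmonic_mean_le_power_mean_mult[OF l] dom])
  fix a b \<tau> :: real assume pos: "0 < a" "0 < b"
  have "0 < (1 - l) / sqrt a + l / sqrt b" using pos l by (intro add_pos_pos) auto
  then show "0 < power_mean_minus_half l a b" by (simp add: power_mean_minus_half_def)
  assume "0 < \<tau>"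
  have "(1 - l) / sqrt (\<tau> * a) + l / sqrt (\<tau> * b) = ((1 - l) / sqrt a + l / sqrt b) / sqrt \<tau>"
    by (simp add: real_sqrt_mult add_divide_distrib mult.commute)
  then show "power_mean_minus_half l (\<tau> * a) (\<tau> * b) = \<tau> * power_mean_minus_half l a b"
    using \<open>0 < \<tau>\<close> by (simp add: power_mean_minus_half_def power_divide divide_inverse power_mult_distrib power_inverse)
qed

text \<open>On compact intervals the map \<open>s \<mapsto> - (1 / s)\<close> is increasing, so monotone substitution applies after a
reflection; the half-line is exhausted by such intervals.\<close>
lemma nn_integral_inverse_substitution:
  fixes f :: "real \<Rightarrow> ennreal"
  assumes [measurable]: "f \<in> borel_measurable borel"
  shows "(\<integral>\<^sup>+r. f r * indicator {0<..} r \<partial>lborel)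
    = (\<integral>\<^sup>+s. f (1 / s) * ennreal (1 / s\<^sup>2) * indicator {0<..} s \<partial>lborel)"
proof -
  \<comment> \<open>The shift by 2 keeps the endpoints strictly ordered already for \<open>k = 0\<close>.\<close>
  define A where "A = (\<lambda>k::nat. {1 / (real k + 2)..real k + 2})"
  have A: "incseq A"
  proof (rule incseq_SucI)
    fix k have "1 / (real (Suc k) + 2) \<le> 1 / (real k + 2)" by (intro divide_left_mono) auto
    then show "A k \<subseteq> A (Suc k)" by (auto simp: A_def)
  qed
  have UA: "(\<Union>k. A k) = {0<..}"
  proof (intro equalityI subsetI)
    fix x assume "x \<in> (\<Union>k. A k)"
    then obtain k where "1 / (real k + 2) \<le> x" by (auto simp: A_def)
    moreover have "0 < 1 / (real k + 2)" by simp
    ultimately show "x \<in> {0<..}" unfolding greaterThan_iff by (rule less_le_trans[rotated])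
  next
    fix x :: real assume "x \<in> {0<..}"
    then have "0 < x" by simp
    obtain k :: nat where k: "max x (1 / x) \<le> real k" using real_arch_simple by blast
    then have "1 \<le> x * real k" using \<open>0 < x\<close> by (simp add: pos_divide_le_eq mult.commute)
    then have "1 \<le> x * (real k + 2)" using \<open>0 < x\<close> by (simp add: distrib_left)
    then have "1 / (real k + 2) \<le> x" by (simp add: pos_divide_le_eq)
    then show "x \<in> (\<Union>k. A k)" using k by (auto simp: A_def intro!: exI[of _ k])
  qed
  have sup: "(\<integral>\<^sup>+x. g x * indicator {0<..} x \<partial>lborel) = (SUP k. \<integral>\<^sup>+x. g x * indicator (A k) x \<partial>lborel)"
    if [measurable]: "g \<in> borel_measurable borel" for g :: "real \<Rightarrow> ennreal"
  proof -
    have "(\<integral>\<^sup>+x. g x * indicator {0<..} x \<partial>lborel) = emeasure (density lborel g) (\<Union>k. A k)"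
      unfolding UA by (simp add: emeasure_density)
    also have "\<dots> = (SUP k. emeasure (density lborel g) (A k))"
      using A by (intro SUP_emeasure_incseq[symmetric]) (auto simp: A_def)
    also have "\<dots> = (SUP k. \<integral>\<^sup>+x. g x * indicator (A k) x \<partial>lborel)"
      by (simp add: emeasure_density A_def)
    finally show ?thesis .
  qed
  have "(\<integral>\<^sup>+x. f x * indicator (A k) x \<partial>lborel) = (\<integral>\<^sup>+s. f (1 / s) * ennreal (1 / s\<^sup>2) * indicator (A k) s \<partial>lborel)" for k
  proof -
    let ?a = "1 / (real k + 2)" and ?b = "real k + 2"
    have ab: "0 < ?a" "?a < ?b"
      using less_trans[of ?a 1 ?b] by auto
    have "(\<integral>\<^sup>+x. f x * indicator (A k) x \<partial>lborel)
        = (\<integral>\<^sup>+x. f (0 + (- 1) * x) * indicator (A k) (0 + (- 1) * x) \<partial>lborel)"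
      by (subst nn_integral_real_affine[where c="- 1" and t=0]) (auto simp: A_def)
    also have "\<dots> = (\<integral>\<^sup>+x. f (- x) * indicator {- (1 / ?a)..- (1 / ?b)} x \<partial>lborel)"
      by (intro nn_integral_cong) (auto simp: A_def indicator_def)
    also have "\<dots> = (\<integral>\<^sup>+x. f (- (- (1 / x))) * ennreal (1 / x\<^sup>2) * indicator {?a..?b} x \<partial>lborel)"
    proof (rule nn_integral_substitution_aux[OF _ _ _ _ _ ab(2), where g="\<lambda>x. - (1 / x)" and f="\<lambda>x. f (- x)"])
      fix x assume "x \<in> {?a..?b}"
      then have "0 < x" using ab(1) less_le_trans by (auto simp only: atLeastAtMost_iff)
      then show "((\<lambda>x. - (1 / x)) has_real_derivative 1 / x\<^sup>2) (at x)"
        by (auto intro!: derivative_eq_intros simp: power2_eq_square)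
    qed (use ab(1) in \<open>auto intro!: continuous_intros\<close>)
    finally show ?thesis by (simp add: A_def)
  qed
  then show ?thesis by (subst (1 2) sup) auto
qed

text \<open>The weight \<open>t\<close> depends on \<open>s0\<close> and \<open>s1\<close>, the mean on the left does not. The arithmetic-geometric
inequality for \<open>1 / (s0 * sqrt \<alpha>)\<close> and \<open>1 / (s1 * sqrt \<beta>)\<close> with weight \<open>t\<close> cancels the dependence,
because \<open>1 - t = (1 - l) * s0 / s\<close> and \<open>t = l * s1 / s\<close>.\<close>
lemma power_mean_le_geometric:
  assumes l: "0 < l" "l < 1" and pos: "0 < s0" "0 < s1" "0 < \<alpha>" "0 < \<beta>"
    and s: "s = (1 - l) * s0 + l * s1" and t: "t = l * s1 / s"
  shows "power_mean_minus_half l \<alpha> \<beta> \<le> geometric_mean t (\<alpha> * s0\<^sup>2) (\<beta> * s1\<^sup>2) / s\<^sup>2"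
proof -
  define A where "A = 1 / (s0 * sqrt \<alpha>)"
  define B where "B = 1 / (s1 * sqrt \<beta>)"
  have AB: "0 < A" "0 < B" using pos by (auto simp: A_def B_def)
  have s0: "0 < s" unfolding s using l pos by (intro add_pos_pos) auto
  have t': "1 - t = (1 - l) * s0 / s" using s0 by (simp add: t field_simps) (simp add: s algebra_simps)
  have "0 < 1 - t" "0 < t" unfolding t' using s0 l pos by (auto simp: t)
  then have "geometric_mean t A B \<le> (1 - t) * A + t * B"
    using AB by (intro geometric_mean_le_arithmetic_mean) auto
  also have "\<dots> = ((1 - l) / sqrt \<alpha> + l / sqrt \<beta>) / s"
    unfolding t' using pos s0 by (simp add: t A_def B_def add_divide_distrib mult.commute)
  finally have le: "geometric_mean t A B * s \<le> (1 - l) / sqrt \<alpha> + l / sqrt \<beta>"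
    using s0 by (simp add: pos_le_divide_eq)
  have G: "0 < geometric_mean t A B" using AB by (rule geometric_mean_pos)
  have "geometric_mean t (\<alpha> * s0\<^sup>2) (\<beta> * s1\<^sup>2) * (geometric_mean t A B * geometric_mean t A B)
      = geometric_mean t ((\<alpha> * s0\<^sup>2) * (A * A)) ((\<beta> * s1\<^sup>2) * (B * B))"
    using AB pos by (simp add: geometric_mean_mult)
  moreover have "(\<alpha> * s0\<^sup>2) * (A * A) = 1" "(\<beta> * s1\<^sup>2) * (B * B) = 1"
    using pos by (auto simp: A_def B_def power2_eq_square)
  ultimately have "geometric_mean t (\<alpha> * s0\<^sup>2) (\<beta> * s1\<^sup>2) * (geometric_mean t A B)\<^sup>2 = 1"
    by (simp add: geometric_mean_refl power2_eq_square)
  then have "geometric_mean t (\<alpha> * s0\<^sup>2) (\<beta> * s1\<^sup>2) = inverse ((geometric_mean t A B)\<^sup>2)"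
    using G by (simp add: field_simps)
  then have "geometric_mean t (\<alpha> * s0\<^sup>2) (\<beta> * s1\<^sup>2) / s\<^sup>2 = inverse ((geometric_mean t A B * s)\<^sup>2)"
    by (simp add: power_mult_distrib divide_inverse)
  moreover have "inverse (((1 - l) / sqrt \<alpha> + l / sqrt \<beta>)\<^sup>2) \<le> inverse ((geometric_mean t A B * s)\<^sup>2)"
    using le G s0 by (intro le_imp_inverse_le power_mono) auto
  ultimately show ?thesis by (simp add: power_mean_minus_half_def)
qed

text \<open>In the variable \<open>s = 1 / r\<close> the heights in the hypothesis combine affinely with weight \<open>l\<close>. The factor
\<open>1 / s\<^sup>2\<close> coming from the substitution turns the geometric means with varying weight into power means
with the fixed weight \<open>l\<close>.\<close>
lemma radial_inequality:
  fixes F G H :: "real \<Rightarrow> ennreal"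
  assumes l: "0 < l" "l < 1"
    and [measurable]: "F \<in> borel_measurable borel" "G \<in> borel_measurable borel" "H \<in> borel_measurable borel"
    and dom: "\<And>r\<^sub>0 r\<^sub>1 r t. 0 < r\<^sub>0 \<Longrightarrow> 0 < r\<^sub>1 \<Longrightarrow> 0 < r \<Longrightarrow> 0 < t \<Longrightarrow> t < 1 \<Longrightarrow>
      (1 - t) * r\<^sub>0 = (1 - l) * r \<Longrightarrow> t * r\<^sub>1 = l * r \<Longrightarrow> mean_dom (geometric_mean t) (F r\<^sub>0) (G r\<^sub>1) (H r)"
  shows "mean_dom (harmonic_mean l) (\<integral>\<^sup>+r. F r * indicator {0<..} r \<partial>lborel)
    (\<integral>\<^sup>+r. G r * indicator {0<..} r \<partial>lborel) (\<integral>\<^sup>+r. H r * indicator {0<..} r \<partial>lborel)"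
proof -
  define T where "T = (\<lambda>(f :: real \<Rightarrow> ennreal) s. f (1 / s) * ennreal (1 / s\<^sup>2) * indicator {0<..} s)"
  have [measurable]: "T f \<in> borel_measurable borel" if [measurable]: "f \<in> borel_measurable borel" for f
    unfolding T_def by measurable
  have lessT: "0 < s \<and> ennreal (\<alpha> * s\<^sup>2) < f (1 / s)" if "ennreal \<alpha> < T f s" "0 < \<alpha>" for \<alpha> f s
  proof -
    have s: "0 < s" using that(1) by (cases "0 < s") (auto simp: T_def)
    have "ennreal (\<alpha> * s\<^sup>2) < f (1 / s)"
    proof (rule ccontr)
      assume "\<not> ennreal (\<alpha> * s\<^sup>2) < f (1 / s)"
      then have "f (1 / s) * ennreal (1 / s\<^sup>2) \<le> ennreal (\<alpha> * s\<^sup>2) * ennreal (1 / s\<^sup>2)"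
        by (intro mult_right_mono) auto
      also have "\<dots> = ennreal \<alpha>" using s that(2) by (simp add: ennreal_mult[symmetric])
      finally show False using that(1) s by (simp add: T_def)
    qed
    then show ?thesis using s by blast
  qed
  have "mean_dom (power_mean_minus_half l) (T F s0) (T G s1) (T H ((1 - l) * s0 + l * s1))" for s0 s1
    unfolding mean_dom_def
  proof (intro allI impI)
    fix \<alpha> \<beta> :: real
    assume \<alpha>: "0 < \<alpha>" "ennreal \<alpha> < T F s0" and \<beta>: "0 < \<beta>" "ennreal \<beta> < T G s1"
    have F: "0 < s0" "ennreal (\<alpha> * s0\<^sup>2) < F (1 / s0)" using lessT[OF \<alpha>(2,1)] by auto
    have G: "0 < s1" "ennreal (\<beta> * s1\<^sup>2) < G (1 / s1)" using lessT[OF \<beta>(2,1)] by auto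
    define s where "s = (1 - l) * s0 + l * s1"
    define t where "t = l * s1 / s"
    have s: "0 < s" unfolding s_def using l F G by (intro add_pos_pos) auto
    have t': "1 - t = (1 - l) * s0 / s" using s by (simp add: t_def field_simps) (simp add: s_def algebra_simps)
    have t: "0 < 1 - t" "0 < t" unfolding t' using s l F G by (auto simp: t_def)
    have "mean_dom (geometric_mean t) (F (1 / s0)) (G (1 / s1)) (H (1 / s))"
    proof (rule dom)
      show "(1 - t) * (1 / s0) = (1 - l) * (1 / s)" unfolding t' using F(1) s by simp
      show "t * (1 / s1) = l * (1 / s)" unfolding t_def using G(1) s by simp
    qed (use F G s t in auto)
    then have H: "ennreal (geometric_mean t (\<alpha> * s0\<^sup>2) (\<beta> * s1\<^sup>2)) \<le> H (1 / s)"
      using F G \<alpha> \<beta> by (intro mean_domD) auto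
    have "ennreal (power_mean_minus_half l \<alpha> \<beta>) \<le> ennreal (geometric_mean t (\<alpha> * s0\<^sup>2) (\<beta> * s1\<^sup>2) * (1 / s\<^sup>2))"
      using power_mean_le_geometric[OF l F(1) G(1) \<alpha>(1) \<beta>(1) s_def t_def] by (intro ennreal_leI) simp
    also have "\<dots> = ennreal (geometric_mean t (\<alpha> * s0\<^sup>2) (\<beta> * s1\<^sup>2)) * ennreal (1 / s\<^sup>2)"
      by (intro ennreal_mult) (auto simp: geometric_mean_def)
    also have "\<dots> \<le> H (1 / s) * ennreal (1 / s\<^sup>2)"
      using H by (intro mult_right_mono) auto
    also have "\<dots> = T H ((1 - l) * s0 + l * s1)" using s by (simp add: T_def s_def)
    finally show "ennreal (power_mean_minus_half l \<alpha> \<beta>) \<le> T H ((1 - l) * s0 + l * s1)" .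
  qed
  then have "mean_dom (harmonic_mean l) (\<integral>\<^sup>+s. T F s \<partial>lborel) (\<integral>\<^sup>+s. T G s \<partial>lborel) (\<integral>\<^sup>+s. T H s \<partial>lborel)"
    by (intro borell_brascamp_lieb_real l) auto
  moreover have "(\<integral>\<^sup>+s. T f s \<partial>lborel) = (\<integral>\<^sup>+r. f r * indicator {0<..} r \<partial>lborel)"
    if "f \<in> borel_measurable borel" for f
    unfolding T_def using that by (rule nn_integral_inverse_substitution[symmetric])
  ultimately show ?thesis by simp
qed

lemma inverse_ennreal_antimono:
  fixes a b :: ennreal
  assumes "a \<le> b"
  shows "inverse b \<le> inverse a"
proof (cases "a = 0 \<or> b = \<infinity>")
  case False
  then obtain a' b' where "a = ennreal a'" "b = ennreal b'" "0 < a'" "a' \<le> b'"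
    using assms by (cases a; cases b) (auto simp: top_unique)
  then show ?thesis by (simp add: inverse_ennreal le_imp_inverse_le)
qed auto

text \<open>Approximation of \<open>a\<close> and \<open>b\<close> from strictly below, which also covers infinite values.\<close>
lemma mean_dom_harmonic_inverse:
  assumes l: "0 < l" "l < 1" and dom: "mean_dom (harmonic_mean l) a b c"
  shows "inverse c \<le> ennreal (1 - l) * inverse a + ennreal l * inverse b"
proof (cases "a = 0 \<or> b = 0")
  case True
  then show ?thesis using l by (auto simp: ennreal_mult_top)
next
  case False
  then have "0 < a" "0 < b" by (auto simp: zero_less_iff_neq_zero)
  obtain u where u: "\<And>n::nat. u n < a" "u \<longlonglongrightarrow> a"
    using approx_from_below_dense_linorder[OF \<open>0 < a\<close>] by blast
  obtain v where v: "\<And>n::nat. v n < b" "v \<longlonglongrightarrow> b"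
    using approx_from_below_dense_linorder[OF \<open>0 < b\<close>] by blast
  have inv: "isCont (inverse :: ennreal \<Rightarrow> ennreal) x" for x
    using continuous_on_inverse_ennreal[OF continuous_on_id, of UNIV]
    by (simp add: continuous_on_eq_continuous_at id_def)
  have "(\<lambda>n. ennreal (1 - l) * inverse (u n) + ennreal l * inverse (v n))
      \<longlonglongrightarrow> ennreal (1 - l) * inverse a + ennreal l * inverse b"
    using l by (intro tendsto_add ennreal_tendsto_cmult isCont_tendsto_compose[OF inv] u v) auto
  moreover have "\<forall>\<^sub>F n in sequentially. inverse c \<le> ennreal (1 - l) * inverse (u n) + ennreal l * inverse (v n)"
    using order_tendstoD(1)[OF u(2) \<open>0 < a\<close>] order_tendstoD(1)[OF v(2) \<open>0 < b\<close>]
  proof eventually_elim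
    case (elim n)
    obtain \<alpha> where \<alpha>: "u n = ennreal \<alpha>" "0 < \<alpha>"
      using elim u(1)[of n] by (cases "u n") (auto simp: ennreal_less_zero_iff)
    obtain \<beta> where \<beta>: "v n = ennreal \<beta>" "0 < \<beta>"
      using elim v(1)[of n] by (cases "v n") (auto simp: ennreal_less_zero_iff)
    have pos: "0 < (1 - l) / \<alpha> + l / \<beta>" using l \<alpha> \<beta> by (intro add_pos_pos) auto
    have "ennreal (harmonic_mean l \<alpha> \<beta>) \<le> c"
      using \<alpha> \<beta> u(1)[of n] v(1)[of n] by (intro mean_domD[OF dom]) auto
    then have "inverse c \<le> inverse (ennreal (harmonic_mean l \<alpha> \<beta>))"
      by (rule inverse_ennreal_antimono)
    also have "\<dots> = ennreal ((1 - l) / \<alpha> + l / \<beta>)"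
      using pos by (simp add: harmonic_mean_def inverse_ennreal)
    also have "\<dots> = ennreal (1 - l) * inverse (u n) + ennreal l * inverse (v n)"
      using l \<alpha> \<beta> by (simp add: inverse_ennreal ennreal_mult[symmetric] divide_inverse)
    finally show ?case .
  qed
  ultimately show ?thesis by (intro tendsto_lowerbound) auto
qed

lemma ennreal_divide_scaled:
  assumes "0 < k" "k < \<infinity>" "0 < m"
  shows "ennreal m / (k * ennreal m * J) = inverse k * inverse J"
proof -
  obtain k' where k: "k = ennreal k'" "0 < k'" using assms by (cases k) (auto simp: ennreal_less_zero_iff)
  show ?thesis
  proof (cases J)
    case (real j)
    show ?thesis
    proof (cases "j = 0")
      case True
      then show ?thesis using k real assms by (simp add: inverse_ennreal ennreal_mult_top divide_ennreal_def)
    next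
      case False
      then have "0 < j" using real by simp
      then show ?thesis unfolding real(2) k(1)
        using k(2) assms(3) by (simp add: ennreal_mult[symmetric] divide_ennreal inverse_ennreal divide_inverse)
    qed
  next
    case top
    then show ?thesis using k assms by (simp add: ennreal_mult_top ennreal_mult[symmetric])
  qed
qed

section \<open>Hausdorff measure: Borel sets, isometries, local finiteness\<close>

lemma hausdorff_gauge_image_nonexpansive:
  fixes f :: "'a::metric_space \<Rightarrow> 'b::metric_space"
  assumes f: "\<And>x y. x \<in> S \<Longrightarrow> y \<in> S \<Longrightarrow> dist (f x) (f y) \<le> dist x y" and C: "bounded C"
  shows "bounded (f ` (C \<inter> S))" "diameter (f ` (C \<inter> S)) \<le> diameter C"
    "hausdorff_gauge d (f ` (C \<inter> S)) \<le> hausdorff_gauge d C"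
proof -
  have le: "dist (f x) (f y) \<le> diameter C" if "x \<in> C \<inter> S" "y \<in> C \<inter> S" for x y
    using f[of x y] diameter_bounded_bound[OF C, of x y] that by auto
  then show "bounded (f ` (C \<inter> S))"
    unfolding bounded_two_points by blast
  show diam: "diameter (f ` (C \<inter> S)) \<le> diameter C"
  proof (cases "C \<inter> S = {}")
    case False
    then show ?thesis
      using le by (subst diameter_def) (auto intro!: cSUP_least)
  qed (simp add: diameter_ge_0 C)
  have "0 \<le> diameter (f ` (C \<inter> S))"
    using \<open>bounded (f ` (C \<inter> S))\<close> by (rule diameter_ge_0)
  then show "hausdorff_gauge d (f ` (C \<inter> S)) \<le> hausdorff_gauge d C"
    using diam by (auto simp: hausdorff_gauge_def intro!: ennreal_leI mult_left_mono power_mono)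
qed

lemma hausdorff_outer_image_nonexpansive:
  fixes f :: "'a::metric_space \<Rightarrow> 'b::metric_space"
  assumes f: "\<And>x y. x \<in> S \<Longrightarrow> y \<in> S \<Longrightarrow> dist (f x) (f y) \<le> dist x y"
  shows "hausdorff_outer d (f ` S) \<le> hausdorff_outer d S"
  unfolding hausdorff_outer_def
proof (rule SUP_mono, intro bexI)
  fix \<delta> :: real assume "\<delta> \<in> {0<..}"
  then show "\<delta> \<in> {0<..}" .
  show "hausdorff_premeasure d \<delta> (f ` S) \<le> hausdorff_premeasure d \<delta> S"
    unfolding hausdorff_premeasure_def
  proof (rule INF_mono)
    fix C :: "nat \<Rightarrow> 'a set"
    assume C: "C \<in> {C. S \<subseteq> (\<Union>i. C i) \<and> (\<forall>i. bounded (C i) \<and> diameter (C i) \<le> \<delta>)}"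
    let ?D = "\<lambda>i. f ` (C i \<inter> S)"
    note g = hausdorff_gauge_image_nonexpansive[of S f, OF f]
    have "S \<subseteq> (\<Union>i. C i)" using C by simp
    then have "f ` S \<subseteq> (\<Union>i. ?D i)" by blast
    moreover have "bounded (?D i)" "diameter (?D i) \<le> \<delta>" for i
      using C g(1,2)[of "C i"] by (auto intro: order_trans)
    moreover have "(\<Sum>i. hausdorff_gauge d (?D i)) \<le> (\<Sum>i. hausdorff_gauge d (C i))"
      using C by (intro suminf_le g(3)) auto
    ultimately show "\<exists>D\<in>{C. f ` S \<subseteq> (\<Union>i. C i) \<and> (\<forall>i. bounded (C i) \<and> diameter (C i) \<le> \<delta>)}.
        (\<Sum>i. hausdorff_gauge d (D i)) \<le> (\<Sum>i. hausdorff_gauge d (C i))"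
      by (intro bexI[of _ ?D]) auto
  qed
qed

lemma hausdorff_premeasure_antimono:
  "\<delta> \<le> \<delta>' \<Longrightarrow> hausdorff_premeasure d \<delta>' S \<le> hausdorff_premeasure d \<delta> S"
  unfolding hausdorff_premeasure_def by (rule INF_superset_mono) (auto intro: order_trans)

text \<open>At mesh \<open>\<delta>\<close> no set of a cover can meet both parts, so a cover of the union splits into covers of the parts.\<close>
lemma hausdorff_premeasure_separated:
  assumes sep: "\<And>x y. x \<in> A \<Longrightarrow> y \<in> B \<Longrightarrow> \<delta> < dist x y"
  shows "hausdorff_premeasure d \<delta> A + hausdorff_premeasure d \<delta> B \<le> hausdorff_premeasure d \<delta> (A \<union> B)"
  unfolding hausdorff_premeasure_def[of d \<delta> "A \<union> B"]
proof (rule INF_greatest)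
  fix C :: "nat \<Rightarrow> 'a set"
  assume "C \<in> {C. A \<union> B \<subseteq> (\<Union>i. C i) \<and> (\<forall>i. bounded (C i) \<and> diameter (C i) \<le> \<delta>)}"
  then have cov: "A \<union> B \<subseteq> (\<Union>i. C i)" and C: "\<And>i. bounded (C i)" "\<And>i. diameter (C i) \<le> \<delta>"
    by auto
  have "0 \<le> \<delta>" using C[of 0] diameter_ge_0 order_trans by blast
  define R where "R = (\<lambda>S i. if C i \<inter> S = {} then {} else C i)"
  have prem: "hausdorff_premeasure d \<delta> S \<le> (\<Sum>i. hausdorff_gauge d (R S i))" if sub: "S \<subseteq> A \<union> B" for S
  proof -
    have "S \<subseteq> (\<Union>i. R S i)"
    proof
      fix x assume "x \<in> S"
      then obtain i where "x \<in> C i" using cov sub by blast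
      then have "x \<in> R S i" using \<open>x \<in> S\<close> by (auto simp: R_def)
      then show "x \<in> (\<Union>i. R S i)" by blast
    qed
    then show ?thesis
      unfolding hausdorff_premeasure_def using C \<open>0 \<le> \<delta>\<close>
      by (intro INF_lower) (auto simp: R_def)
  qed
  have "C i \<inter> A = {} \<or> C i \<inter> B = {}" for i
  proof (rule ccontr)
    assume "\<not> (C i \<inter> A = {} \<or> C i \<inter> B = {})"
    then obtain x y where xy: "x \<in> C i" "x \<in> A" "y \<in> C i" "y \<in> B" by blast
    then have "dist x y \<le> \<delta>" using diameter_bounded_bound[OF C(1), of x i y] C(2)[of i] by simp
    then show False using sep[of x y] xy by simp
  qed
  then have sum: "hausdorff_gauge d (R A i) + hausdorff_gauge d (R B i) \<le> hausdorff_gauge d (C i)" for i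
    by (metis R_def add.right_neutral add_0 hausdorff_gauge_def order_refl zero_le)
  have "hausdorff_premeasure d \<delta> A + hausdorff_premeasure d \<delta> B
      \<le> (\<Sum>i. hausdorff_gauge d (R A i)) + (\<Sum>i. hausdorff_gauge d (R B i))"
    by (intro add_mono prem) auto
  also have "\<dots> = (\<Sum>i. hausdorff_gauge d (R A i) + hausdorff_gauge d (R B i))"
    by (rule suminf_add) auto
  also have "\<dots> \<le> (\<Sum>i. hausdorff_gauge d (C i))"
    by (intro suminf_le sum) auto
  finally show "hausdorff_premeasure d \<delta> A + hausdorff_premeasure d \<delta> B \<le> (\<Sum>i. hausdorff_gauge d (C i))" .
qed

lemma hausdorff_outer_separated:
  assumes "0 < e" and sep: "\<And>x y. x \<in> A \<Longrightarrow> y \<in> B \<Longrightarrow> e \<le> dist x y"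
  shows "hausdorff_outer d A + hausdorff_outer d B \<le> hausdorff_outer d (A \<union> B)"
proof -
  have *: "hausdorff_premeasure d \<delta> A + hausdorff_premeasure d \<delta>' B \<le> hausdorff_outer d (A \<union> B)"
    if "\<delta> \<in> {0<..}" "\<delta>' \<in> {0<..}" for \<delta> \<delta>'
  proof -
    \<comment> \<open>Below the separation \<open>e\<close>, and at most both meshes, so that the premeasures only grow.\<close>
    define \<eta> where "\<eta> = min (min \<delta> \<delta>') (e / 2)"
    have "0 < \<eta>" "\<eta> < e" using that assms(1) by (auto simp: \<eta>_def)
    have "hausdorff_premeasure d \<delta> A + hausdorff_premeasure d \<delta>' B
        \<le> hausdorff_premeasure d \<eta> A + hausdorff_premeasure d \<eta> B"
      by (intro add_mono hausdorff_premeasure_antimono) (auto simp: \<eta>_def)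
    also have "\<dots> \<le> hausdorff_premeasure d \<eta> (A \<union> B)"
      using \<open>\<eta> < e\<close> sep by (intro hausdorff_premeasure_separated) (meson less_le_trans)
    also have "\<dots> \<le> hausdorff_outer d (A \<union> B)"
      unfolding hausdorff_outer_def using \<open>0 < \<eta>\<close> by (intro SUP_upper) auto
    finally show ?thesis .
  qed
  have ne: "{0::real<..} \<noteq> {}" by (auto intro: gt_ex)
  have "hausdorff_outer d A + hausdorff_outer d B
      = (SUP \<delta>'\<in>{0<..}. SUP \<delta>\<in>{0<..}. hausdorff_premeasure d \<delta> A + hausdorff_premeasure d \<delta>' B)"
    unfolding hausdorff_outer_def by (simp add: ne ennreal_SUP_add_left ennreal_SUP_add_right)
  also have "\<dots> \<le> hausdorff_outer d (A \<union> B)"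
    by (intro SUP_least *)
  finally show ?thesis .
qed

lemma hausdorff_outer_mono: "S \<subseteq> T \<Longrightarrow> hausdorff_outer d S \<le> hausdorff_outer d T"
  using outer_measure_space_hausdorff_outer[of d]
  by (auto simp: outer_measure_space_def increasing_def)

lemma hausdorff_outer_empty: "hausdorff_outer d {} = 0"
  using outer_measure_space_hausdorff_outer[of d]
  by (auto simp: outer_measure_space_def positive_def)

lemma hausdorff_outer_UN_le: "hausdorff_outer d (\<Union>i::nat. A i) \<le> (\<Sum>i. hausdorff_outer d (A i))"
  unfolding hausdorff_outer_def
  by (rule SUP_least, rule order_trans[OF hausdorff_premeasure_subadditive])
     (intro suminf_le SUP_upper, auto)

text \<open>Caratheodory's criterion for metric outer measures. The set \<open>A - F\<close> is exhausted by the points at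
distance at least \<open>1 / (n + 1)\<close> from \<open>F\<close>, where separation gives additivity, and the remainder consists
of thin rings around \<open>F\<close>. Rings of the same parity are separated from each other, so the measures of all
rings have a finite sum, and its tails bound the error.\<close>
lemma closed_in_hausdorff_sets:
  fixes F :: "'a::metric_space set"
  assumes F: "closed F"
  shows "F \<in> sets (hausdorff_measure d)"
proof -
  let ?H = "hausdorff_outer d :: 'a set \<Rightarrow> ennreal"
  have main: "?H (F \<inter> A) + ?H (A - F) \<le> ?H A" if fin: "?H A < \<infinity>" and ne: "F \<noteq> {}" for A
  proof -
    define Sn where "Sn = (\<lambda>n::nat. {x \<in> A. 1 / (real n + 1) \<le> infdist x F})"
    define R where "R = (\<lambda>n::nat. {x \<in> A. 1 / (real n + 2) \<le> infdist x F \<and> infdist x F < 1 / (real n + 1)})"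
    have sep_infdist: "b - a \<le> dist x y" if "b \<le> infdist x F" "infdist y F \<le> a" for x y a b
      using infdist_triangle[of x F y] that by linarith
    have core: "?H (F \<inter> A) + ?H (Sn n) \<le> ?H A" for n
    proof -
      have "?H (F \<inter> A) + ?H (Sn n) \<le> ?H (F \<inter> A \<union> Sn n)"
      proof (rule hausdorff_outer_separated)
        show "0 < 1 / (real n + 1)" by simp
        show "1 / (real n + 1) \<le> dist x y" if "x \<in> F \<inter> A" "y \<in> Sn n" for x y
          using sep_infdist[of "1 / (real n + 1)" y x 0] that by (auto simp: Sn_def dist_commute)
      qed
      also have "\<dots> \<le> ?H A" by (intro hausdorff_outer_mono) (auto simp: Sn_def)
      finally show ?thesis .
    qed
    have rings: "(\<Sum>i<m. ?H (R (2 * i + p))) \<le> ?H (\<Union>i<m. R (2 * i + p))" for m p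
    proof (induction m)
      case (Suc m)
      have "(\<Sum>i<Suc m. ?H (R (2 * i + p))) \<le> ?H (\<Union>i<m. R (2 * i + p)) + ?H (R (2 * m + p))"
        using Suc by (simp add: add_mono)
      also have "\<dots> \<le> ?H ((\<Union>i<m. R (2 * i + p)) \<union> R (2 * m + p))"
      proof (rule hausdorff_outer_separated)
        let ?k = "real (2 * m + p)"
        have "1 / (?k + 1) < 1 / ?k" if "m \<noteq> 0"
          using that by (intro divide_strict_left_mono) auto
        then show "0 < (if m = 0 then 1 else 1 / ?k - 1 / (?k + 1))" by auto
        fix x y assume "x \<in> (\<Union>i<m. R (2 * i + p))" and y: "y \<in> R (2 * m + p)"
        then obtain i where i: "i < m" "x \<in> R (2 * i + p)" by blast
        then have "1 / ?k \<le> 1 / (real (2 * i + p) + 2)"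
          by (intro divide_left_mono) auto
        also have "\<dots> \<le> infdist x F" using i by (simp add: R_def)
        finally show "(if m = 0 then 1 else 1 / ?k - 1 / (?k + 1)) \<le> dist x y"
          using sep_infdist[of "1 / ?k" x y "1 / (?k + 1)"] i y by (auto simp: R_def)
      qed
      also have "(\<Union>i<m. R (2 * i + p)) \<union> R (2 * m + p) = (\<Union>i<Suc m. R (2 * i + p))"
        by (auto simp: less_Suc_eq)
      finally show ?case .
    qed simp
    have rings': "(\<Sum>i<m. ?H (R (2 * i + p))) \<le> ?H A" for m p
      by (rule order_trans[OF rings hausdorff_outer_mono]) (auto simp: R_def)
    have "(\<Sum>k<n. ?H (R k)) \<le> ?H A + ?H A" for n
    proof -
      have "(\<Sum>k<n. ?H (R k)) \<le> (\<Sum>k<2 * n. ?H (R k))"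
        by (intro sum_mono2) auto
      also have "\<dots> = (\<Sum>i<n. ?H (R (2 * i + 0))) + (\<Sum>i<n. ?H (R (2 * i + 1)))"
        by (induction n) (auto simp: algebra_simps)
      also have "\<dots> \<le> ?H A + ?H A" by (intro add_mono rings')
      finally show ?thesis .
    qed
    then have "(\<Sum>k. ?H (R k)) \<le> ?H A + ?H A"
      by (intro suminf_le_const) auto
    then have T: "(\<Sum>k. ?H (R k)) < \<infinity>" using fin by (auto simp: less_top[symmetric] top_unique)
    have "?H (F \<inter> A) + ?H (A - F) + (\<Sum>k<n. ?H (R k)) \<le> ?H A + (\<Sum>k. ?H (R k))" for n
    proof -
      define W where "W = (\<lambda>k. case k of 0 \<Rightarrow> Sn n | Suc k \<Rightarrow> R (k + n))"
      have "A - F \<subseteq> (\<Union>k. W k)"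
      proof
        fix x assume x: "x \<in> A - F"
        then have pos: "0 < infdist x F"
          using F ne by (metis DiffD2 infdist_pos_not_in_closed)
        show "x \<in> (\<Union>k. W k)"
        proof (cases "x \<in> Sn n")
          case True
          then show ?thesis by (auto simp: W_def intro: exI[of _ 0])
        next
          case False
          then have lt: "infdist x F < 1 / (real n + 1)" using x by (auto simp: Sn_def)
          define P where "P = (\<lambda>k::nat. 1 / (real k + 2) \<le> infdist x F)"
          obtain k where "inverse (real (Suc k)) < infdist x F" using reals_Archimedean[OF pos] by blast
          moreover have "1 / (real k + 2) \<le> inverse (real (Suc k))" by (simp add: field_simps)
          ultimately have "P k" by (simp add: P_def)
          define k0 where "k0 = (LEAST k. P k)"
          have Pk0: "P k0" unfolding k0_def using \<open>P k\<close> by (rule LeastI)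
          have "n \<le> k0"
          proof (rule ccontr)
            assume "\<not> n \<le> k0"
            then have "1 / (real n + 1) \<le> 1 / (real k0 + 2)" by (intro divide_left_mono) auto
            then show False using Pk0 lt by (simp add: P_def)
          qed
          have "infdist x F < 1 / (real k0 + 1)"
          proof (cases "k0 = n")
            case False
            then have "\<not> P (k0 - 1)" using \<open>n \<le> k0\<close> unfolding k0_def
              by (intro not_less_Least) (auto simp: k0_def[symmetric])
            then show ?thesis using False \<open>n \<le> k0\<close> by (auto simp: P_def of_nat_diff add.commute)
          qed (use lt in auto)
          then have "x \<in> R k0" using Pk0 x by (auto simp: R_def P_def)
          then have "x \<in> W (Suc (k0 - n))" using \<open>n \<le> k0\<close> by (simp add: W_def)
          then show ?thesis by blast
        qed
      qed
      then have "?H (A - F) \<le> (\<Sum>k. ?H (W k))"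
        by (rule order_trans[OF hausdorff_outer_mono hausdorff_outer_UN_le])
      also have "\<dots> = (\<Sum>k. ?H (R (k + n))) + ?H (Sn n)"
        using suminf_offset[of "\<lambda>k. ?H (W k)" 1] by (simp add: W_def add.commute)
      finally have "?H (F \<inter> A) + ?H (A - F) + (\<Sum>k<n. ?H (R k))
          \<le> (?H (F \<inter> A) + ?H (Sn n)) + ((\<Sum>k. ?H (R (k + n))) + (\<Sum>k<n. ?H (R k)))"
        by (simp add: ac_simps add_left_mono add_mono)
      also have "(\<Sum>k. ?H (R (k + n))) + (\<Sum>k<n. ?H (R k)) = (\<Sum>k. ?H (R k))"
        using suminf_offset[of "\<lambda>k. ?H (R k)" n] by (simp add: add.commute)
      finally show ?thesis using core[of n] by (meson add_right_mono order_trans)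
    qed
    then have "(SUP n. ?H (F \<inter> A) + ?H (A - F) + (\<Sum>k<n. ?H (R k))) \<le> ?H A + (\<Sum>k. ?H (R k))"
      by (intro SUP_least)
    then have "?H (F \<inter> A) + ?H (A - F) + (\<Sum>k. ?H (R k)) \<le> ?H A + (\<Sum>k. ?H (R k))"
      by (simp add: suminf_eq_SUP ennreal_SUP_add_right)
    then show ?thesis using T
      by (simp add: less_top[symmetric])
  qed
  have "?H (F \<inter> A) + ?H (A - F) = ?H A" for A
  proof (rule antisym)
    define W where "W = (\<lambda>k::nat. if k = 0 then F \<inter> A else if k = 1 then A - F else {})"
    have "?H A \<le> (\<Sum>k. ?H (W k))"
      by (rule order_trans[OF hausdorff_outer_mono hausdorff_outer_UN_le]) (auto simp: W_def)
    also have "\<dots> = (\<Sum>k<2. ?H (W k))"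
      by (intro suminf_finite) (auto simp: W_def hausdorff_outer_empty)
    finally show "?H A \<le> ?H (F \<inter> A) + ?H (A - F)"
      by (simp add: W_def numeral_2_eq_2)
    show "?H (F \<inter> A) + ?H (A - F) \<le> ?H A"
      using main[of A] by (cases "F = {}"; cases "?H A < \<infinity>") (auto simp: hausdorff_outer_empty less_top[symmetric])
  qed
  moreover have "(UNIV - F) \<inter> A = A - F" for A by blast
  ultimately show ?thesis
    unfolding sets_hausdorff_measure lambda_system_def by simp
qed

lemma borel_subset_hausdorff_sets: "sets borel \<subseteq> sets (hausdorff_measure d)"
proof -
  have "S \<in> sets (hausdorff_measure d)" if "open S" for S :: "'a set"
    using sets.compl_sets[OF closed_in_hausdorff_sets[of "- S" d]] that by (simp add: Diff_eq closed_open)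
  then have "sigma_sets (space (hausdorff_measure d :: 'a measure)) {S. open S} \<subseteq> sets (hausdorff_measure d)"
    by (intro sets.sigma_sets_subset) auto
  then show ?thesis by (simp add: sets_borel)
qed

lemma hausdorff_outer_isometric_image:
  fixes f :: "'a::metric_space \<Rightarrow> 'b::metric_space"
  assumes f: "\<And>x y. x \<in> S \<Longrightarrow> y \<in> S \<Longrightarrow> dist (f x) (f y) = dist x y"
  shows "hausdorff_outer d (f ` S) = hausdorff_outer d S"
proof (rule antisym)
  show "hausdorff_outer d (f ` S) \<le> hausdorff_outer d S"
    using f by (intro hausdorff_outer_image_nonexpansive) auto
  have inj: "inj_on f S"
    using f by (intro inj_onI) (metis dist_eq_0_iff)
  have "hausdorff_outer d (inv_into S f ` f ` S) \<le> hausdorff_outer d (f ` S)"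
  proof (rule hausdorff_outer_image_nonexpansive)
    fix x y assume "x \<in> f ` S" "y \<in> f ` S"
    then show "dist (inv_into S f x) (inv_into S f y) \<le> dist x y"
      using f inj by auto
  qed
  then show "hausdorff_outer d S \<le> hausdorff_outer d (f ` S)"
    using inj by (simp add: inv_into_image_cancel)
qed

lemma hausdorff_premeasure_le_finite_cover:
  assumes "finite K" "S \<subseteq> (\<Union>k\<in>K. C k)" "\<And>k. k \<in> K \<Longrightarrow> bounded (C k)" "\<And>k. k \<in> K \<Longrightarrow> diameter (C k) \<le> \<delta>" "0 \<le> \<delta>"
  shows "hausdorff_premeasure d \<delta> S \<le> (\<Sum>k\<in>K. hausdorff_gauge d (C k))"
proof -
  obtain h where h: "bij_betw h {0..<card K} K"
    using ex_bij_betw_nat_finite[OF assms(1)] by blast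
  define D where "D = (\<lambda>i. if i < card K then C (h i) else {})"
  have hK: "h i \<in> K" if "i < card K" for i using h that by (auto simp: bij_betw_def)
  have "S \<subseteq> (\<Union>i. D i)"
  proof
    fix x assume "x \<in> S"
    then obtain k where "k \<in> K" "x \<in> C k" using assms(2) by blast
    moreover obtain i where "i \<in> {0..<card K}" "h i = k"
      using h \<open>k \<in> K\<close> by (metis bij_betw_imp_surj_on imageE)
    ultimately have "x \<in> D i" by (simp add: D_def)
    then show "x \<in> (\<Union>i. D i)" by blast
  qed
  then have "hausdorff_premeasure d \<delta> S \<le> (\<Sum>i. hausdorff_gauge d (D i))"
    unfolding hausdorff_premeasure_def using assms(3-5) hK
    by (intro INF_lower) (auto simp: D_def)
  also have "\<dots> = (\<Sum>i\<in>{0..<card K}. hausdorff_gauge d (D i))"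
    by (intro suminf_finite) (auto simp: D_def hausdorff_gauge_def)
  also have "\<dots> = (\<Sum>i\<in>{0..<card K}. hausdorff_gauge d (C (h i)))"
    by (simp add: D_def)
  also have "\<dots> = (\<Sum>k\<in>K. hausdorff_gauge d (C k))"
    using h by (rule sum.reindex_bij_betw)
  finally show ?thesis .
qed

text \<open>In orthonormal coordinates of \<open>V\<close> the ball is covered by at most \<open>(2 * R * N + 1) ^ d\<close> grid cells of
diameter at most \<open>d / N\<close>; the sum of their gauges is bounded independently of \<open>N\<close>.\<close>
lemma hausdorff_outer_bounded_subspace_finite:
  fixes V :: "'a::euclidean_space set"
  assumes V: "subspace V" "dim V = d"
  shows "hausdorff_outer d (V \<inter> cball 0 (real R)) < \<infinity>"
proof -
  obtain B where B: "B \<subseteq> V" "pairwise orthogonal B" "\<And>b. b \<in> B \<Longrightarrow> norm b = 1"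
      "independent B" "card B = d" "span B = V"
    using orthonormal_basis_subspace[OF V(1)] V(2) by metis
  have finB: "finite B" using B(4) independent_imp_finite by blast
  define M where "M = unit_ball_vol (real d) * ((2 * real R + 1) * (real d / 2)) ^ d"
  have "hausdorff_premeasure d \<delta> (V \<inter> cball 0 (real R)) \<le> ennreal M" if "0 < \<delta>" for \<delta>
  proof -
    define N where "N = nat \<lceil>real d / \<delta>\<rceil> + 1"
    have N: "0 < N" "real d / real N \<le> \<delta>"
    proof -
      have "real d / \<delta> \<le> real N" unfolding N_def by linarith
      then have "real d \<le> \<delta> * real N" using \<open>0 < \<delta>\<close> by (simp add: pos_divide_le_eq mult.commute)
      moreover show "0 < N" by (simp add: N_def)
      ultimately show "real d / real N \<le> \<delta>" by (simp add: pos_divide_le_eq)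
    qed
    define K where "K = (\<Pi>\<^sub>E b\<in>B. {- int (R * N)..int (R * N)})"
    define C where "C = (\<lambda>k. {x \<in> V. \<forall>b\<in>B. \<lfloor>real N * (b \<bullet> x)\<rfloor> = k b})"
    have dist_C: "norm (x - y) \<le> real d / real N" if "x \<in> C k" "y \<in> C k" for x y k
    proof -
      have "x - y \<in> span B" using that V B(6) by (auto simp: C_def subspace_diff)
      then have "x - y = (\<Sum>b\<in>B. (b \<bullet> (x - y)) *\<^sub>R b)"
        using orthonormal_basis_expand[OF B(2,3) _ finB, of "x - y"] by (simp add: inner_commute)
      then have "norm (x - y) = norm (\<Sum>b\<in>B. (b \<bullet> (x - y)) *\<^sub>R b)"
        by (rule arg_cong)
      also have "\<dots> \<le> (\<Sum>b\<in>B. norm ((b \<bullet> (x - y)) *\<^sub>R b))"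
        by (rule norm_sum)
      also have "\<dots> \<le> (\<Sum>b\<in>B. 1 / real N)"
      proof (rule sum_mono)
        fix b assume b: "b \<in> B"
        have "\<lfloor>real N * (b \<bullet> x)\<rfloor> = \<lfloor>real N * (b \<bullet> y)\<rfloor>" using that b by (simp add: C_def)
        then have "\<bar>real N * (b \<bullet> x) - real N * (b \<bullet> y)\<bar> \<le> 1" by linarith
        then have "real N * \<bar>b \<bullet> (x - y)\<bar> \<le> 1"
          by (simp add: inner_diff_right right_diff_distrib[symmetric] abs_mult)
        then show "norm ((b \<bullet> (x - y)) *\<^sub>R b) \<le> 1 / real N"
          using B(3)[OF b] N(1) by (simp add: field_simps)
      qed
      finally show ?thesis by (simp add: B(5))
    qed
    have bounded_C: "bounded (C k)" for k
      unfolding bounded_two_points using dist_C by (auto simp: dist_norm)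
    have diam_C: "diameter (C k) \<le> real d / real N" for k
      using dist_C by (intro diameter_le) auto
    have cover: "V \<inter> cball 0 (real R) \<subseteq> (\<Union>k\<in>K. C k)"
    proof
      fix x assume x: "x \<in> V \<inter> cball 0 (real R)"
      define k where "k = restrict (\<lambda>b. \<lfloor>real N * (b \<bullet> x)\<rfloor>) B"
      have "k \<in> K" unfolding K_def
      proof (rule PiE_I)
        fix b assume b: "b \<in> B"
        have "\<bar>b \<bullet> x\<bar> \<le> norm b * norm x" by (rule Cauchy_Schwarz_ineq2)
        then have "\<bar>b \<bullet> x\<bar> \<le> real R" using B(3)[OF b] x by auto
        then have "real N * (b \<bullet> x) \<le> real N * real R" "real N * (- real R) \<le> real N * (b \<bullet> x)"
          by (intro mult_left_mono; linarith)+
        then have "real N * (b \<bullet> x) \<le> of_int (int (R * N))" "of_int (- int (R * N)) \<le> real N * (b \<bullet> x)"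
          by (simp_all add: mult.commute)
        then show "k b \<in> {- int (R * N)..int (R * N)}"
          using b by (auto simp: k_def le_floor_iff floor_le_iff)
      qed (simp add: k_def)
      moreover have "x \<in> C k" using x by (simp add: C_def k_def)
      ultimately show "x \<in> (\<Union>k\<in>K. C k)" by blast
    qed
    have finK: "finite K" unfolding K_def using finB by (intro finite_PiE) auto
    have cardK: "real (card K) = (2 * real R * real N + 1) ^ d"
    proof -
      have "card K = nat (2 * int (R * N) + 1) ^ d" unfolding K_def using finB B(5) by (simp add: card_PiE mult.commute)
      moreover have "real (nat (2 * int (R * N) + 1)) = 2 * real R * real N + 1" by simp
      ultimately show ?thesis by (metis of_nat_power)
    qed
    have "hausdorff_premeasure d \<delta> (V \<inter> cball 0 (real R)) \<le> (\<Sum>k\<in>K. hausdorff_gauge d (C k))"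
      using finK cover bounded_C diam_C N(2) \<open>0 < \<delta>\<close>
      by (intro hausdorff_premeasure_le_finite_cover) (auto intro: order_trans)
    also have "\<dots> \<le> (\<Sum>k\<in>K. ennreal (unit_ball_vol (real d) * (real d / real N / 2) ^ d))"
      unfolding hausdorff_gauge_def
      using diam_C diameter_ge_0[OF bounded_C]
      by (intro sum_mono) (auto intro!: ennreal_leI mult_left_mono power_mono)
    also have "\<dots> = ennreal (real (card K) * (unit_ball_vol (real d) * (real d / real N / 2) ^ d))"
      by (simp add: ennreal_mult ennreal_of_nat_eq_real_of_nat)
    also have "\<dots> \<le> ennreal M"
    proof (rule ennreal_leI)
      have "(2 * real R * real N + 1) * (real d / real N / 2) = (2 * real R + 1 / real N) * (real d / 2)"
        using N(1) by (simp add: field_simps)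
      also have "\<dots> \<le> (2 * real R + 1) * (real d / 2)"
        using N(1) by (intro mult_right_mono) auto
      finally have "((2 * real R * real N + 1) * (real d / real N / 2)) ^ d \<le> ((2 * real R + 1) * (real d / 2)) ^ d"
        by (intro power_mono) auto
      then have "unit_ball_vol (real d) * ((2 * real R * real N + 1) * (real d / real N / 2)) ^ d \<le> M"
        unfolding M_def by (intro mult_left_mono) auto
      then show "real (card K) * (unit_ball_vol (real d) * (real d / real N / 2) ^ d) \<le> M"
        unfolding cardK power_mult_distrib by (simp add: ac_simps)
    qed
    finally show ?thesis .
  qed
  then have "hausdorff_outer d (V \<inter> cball 0 (real R)) \<le> ennreal M"
    unfolding hausdorff_outer_def by (intro SUP_least) auto
  then show ?thesis by (simp add: order_le_less_trans)
qed

section \<open>Hausdorff measure on hyperplanes through a subspace\<close>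

lemma nn_integral_lborel_translate:
  fixes f :: "'a::euclidean_space \<Rightarrow> ennreal"
  assumes [measurable]: "f \<in> borel_measurable borel"
  shows "(\<integral>\<^sup>+x. f (x + c) \<partial>lborel) = (\<integral>\<^sup>+x. f x \<partial>lborel)"
proof -
  have "(\<integral>\<^sup>+x. f x \<partial>lborel) = (\<integral>\<^sup>+x. f x \<partial>distr lborel borel ((+) c))"
    by (simp add: lborel_distr_plus)
  also have "\<dots> = (\<integral>\<^sup>+x. f (c + x) \<partial>lborel)" by (simp add: nn_integral_distr)
  finally show ?thesis by (simp add: add.commute)
qed

text \<open>Linearity and the conditions on \<open>E\<close> and its orthogonal complement determine \<open>p\<close> as the orthogonal
projection onto \<open>E\<close>. All integrals over \<open>E\<close> are taken through this map.\<close>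
locale orthogonal_projection =
  fixes E :: "'a::euclidean_space set" and p :: "'a \<Rightarrow> 'a"
  assumes sub: "subspace E" and lin: "linear p" and p_in: "p x \<in> E"
    and p_id: "x \<in> E \<Longrightarrow> p x = x" and p_perp: "x \<in> E\<^sup>\<bottom> \<Longrightarrow> p x = 0"
begin

lemma p_add: "p (x + y) = p x + p y" and p_scale: "p (r *\<^sub>R x) = r *\<^sub>R p x"
  and p_diff: "p (x - y) = p x - p y"
  using lin by (auto simp: linear_add linear_cmul linear_diff)

lemma p_continuous: "continuous_on UNIV p"
  using lin by (simp add: linear_continuous_on linear_conv_bounded_linear)

lemma p_measurable [measurable]: "p \<in> borel_measurable borel"
  by (intro borel_measurable_continuous_onI p_continuous)

lemma perp: "w \<in> E\<^sup>\<bottom> \<Longrightarrow> e \<in> E \<Longrightarrow> e \<bullet> w = 0"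
  by (auto simp: orthogonal_comp_def orthogonal_def inner_commute)

text \<open>The unit tube around \<open>E\<close>. It is invariant under translation along \<open>E\<close> and its cross-section is bounded,
so Lebesgue measure on it, pushed forward by \<open>p\<close>, is a multiple of Lebesgue measure on \<open>E\<close>.\<close>
definition tube :: "'a set" where
  "tube = {y. norm (y - p y) < 1}"

definition embed :: "'a \<Rightarrow> 'a \<times> real \<Rightarrow> 'a" where
  "embed w z = p (fst z) + snd z *\<^sub>R w"

definition plane :: "'a \<Rightarrow> 'a set" where
  "plane w = {e + r *\<^sub>R w |e r. e \<in> E}"

text \<open>A multiple of Lebesgue measure on \<open>plane w\<close>, with a factor that is the same for every unit vector \<open>w\<close>
orthogonal to \<open>E\<close>.\<close>
definition plane_measure :: "'a \<Rightarrow> 'a measure" where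
  "plane_measure w = distr (density lborel (\<lambda>z. indicator tube (fst z))) borel (embed w)"

lemma tube_open: "open tube"
  unfolding tube_def
  by (intro open_Collect_less continuous_on_norm continuous_on_diff continuous_on_id
      p_continuous continuous_on_const)

lemma tube_measurable [measurable]: "tube \<in> sets borel"
  using tube_open by simp

lemma embed_measurable [measurable]: "embed w \<in> borel_measurable borel"
  unfolding embed_def borel_prod[symmetric] by measurable

lemma embed_add: "embed w (z + z') = embed w z + embed w z'"
  by (simp add: embed_def p_add scaleR_add_left)

lemma embed_in_plane: "embed w z \<in> plane w"
  unfolding embed_def plane_def using p_in by blast

lemma plane_subspace: "subspace (plane w)"
proof -
  have "plane w = {x + y |x y. x \<in> E \<and> y \<in> span {w}}"
    by (auto simp: plane_def span_singleton)
  then show ?thesis using sub by (simp add: subspace_sums subspace_span)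
qed

lemma plane_borel [measurable]: "plane w \<in> sets borel"
  using plane_subspace by (simp add: closed_subspace)

lemma dim_plane:
  assumes "w \<in> E\<^sup>\<bottom>" "w \<noteq> 0"
  shows "dim (plane w) = dim E + 1"
proof -
  have "w \<notin> E" using perp[OF assms(1), of w] assms(2) by auto
  moreover have "plane w = span (insert w E)"
  proof -
    have "x \<in> plane w" if "x - k *\<^sub>R w \<in> E" for x k
      unfolding plane_def using that by (intro CollectI exI[of _ "x - k *\<^sub>R w"] exI[of _ k]) simp
    moreover have "\<exists>k. x - k *\<^sub>R w \<in> E" if "x \<in> plane w" for x
      using that by (auto simp: plane_def) (metis add_diff_cancel_right')
    ultimately show ?thesis
      by (auto simp: span_insert span_eq_iff[THEN iffD2, OF sub])
  qed
  ultimately show ?thesis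
    using sub by (simp add: dim_insert span_eq_iff[THEN iffD2, OF sub])
qed

lemma plane_scale:
  assumes "c \<noteq> 0"
  shows "plane (c *\<^sub>R w) = plane w"
proof (intro equalityI subsetI)
  fix v assume "v \<in> plane (c *\<^sub>R w)"
  then obtain e r where "e \<in> E" "v = e + (r * c) *\<^sub>R w" by (auto simp: plane_def)
  then show "v \<in> plane w" unfolding plane_def by blast
next
  fix v assume "v \<in> plane w"
  then obtain e r where "e \<in> E" "v = e + r *\<^sub>R w" by (auto simp: plane_def)
  then have "v = e + (r / c) *\<^sub>R (c *\<^sub>R w)" using assms by simp
  then show "v \<in> plane (c *\<^sub>R w)" unfolding plane_def using \<open>e \<in> E\<close> by blast
qed

lemma norm_plane:
  assumes "w \<in> E\<^sup>\<bottom>" "norm w = 1" "e \<in> E"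
  shows "norm (e + r *\<^sub>R w) = sqrt ((norm e)\<^sup>2 + r\<^sup>2)"
proof -
  have "(norm (e + r *\<^sub>R w))\<^sup>2 = (norm e)\<^sup>2 + (norm (r *\<^sub>R w))\<^sup>2"
    using perp[OF assms(1,3)] by (intro norm_add_Pythagorean) (simp add: orthogonal_def)
  also have "\<dots> = (norm e)\<^sup>2 + r\<^sup>2" using assms(2) by simp
  finally show ?thesis by (metis norm_ge_zero real_sqrt_unique)
qed

lemma nn_integral_plane_measure:
  assumes [measurable]: "f \<in> borel_measurable borel"
  shows "(\<integral>\<^sup>+x. f x \<partial>plane_measure w) = (\<integral>\<^sup>+z. indicator tube (fst z) * f (embed w z) \<partial>lborel)"
proof -
  have [measurable]: "(\<lambda>z::'a\<times>real. indicator tube (fst z) :: ennreal) \<in> borel_measurable borel"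
    unfolding borel_prod[symmetric] by measurable
  show ?thesis
    unfolding plane_measure_def by (simp add: nn_integral_distr nn_integral_density)
qed

lemma nn_integral_plane_measure_translate:
  assumes [measurable]: "f \<in> borel_measurable borel" and v: "v \<in> plane w"
  shows "(\<integral>\<^sup>+x. f (x + v) \<partial>plane_measure w) = (\<integral>\<^sup>+x. f x \<partial>plane_measure w)"
proof -
  obtain e r where e: "v = e + r *\<^sub>R w" "e \<in> E" using v by (auto simp: plane_def)
  have [measurable]: "(\<lambda>z::'a\<times>real. indicator tube (fst z) :: ennreal) \<in> borel_measurable borel"
    unfolding borel_prod[symmetric] by measurable
  have v': "embed w (e, r) = v" using e by (simp add: embed_def p_id)
  have s: "fst z + e \<in> tube \<longleftrightarrow> fst z \<in> tube" for z :: "'a \<times> real"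
    using e by (simp add: tube_def p_add p_id)
  have "(\<integral>\<^sup>+x. f (x + v) \<partial>plane_measure w)
      = (\<integral>\<^sup>+z. indicator tube (fst (z + (e, r))) * f (embed w (z + (e, r))) \<partial>lborel)"
    by (simp add: nn_integral_plane_measure embed_add v' indicator_def s)
  also have "\<dots> = (\<integral>\<^sup>+z. indicator tube (fst z) * f (embed w z) \<partial>lborel)"
    by (rule nn_integral_lborel_translate) measurable
  finally show ?thesis by (simp add: nn_integral_plane_measure)
qed

text \<open>Hausdorff measure on \<open>plane w\<close>, as a measure on the Borel sets. It is sigma-finite
for nonzero \<open>w\<close> orthogonal to \<open>E\<close>, as Tonelli's theorem requires.\<close>
definition hausdorff_plane :: "'a \<Rightarrow> 'a measure" where
  "hausdorff_plane w = density (distr (hausdorff_measure (dim E + 1)) borel (\<lambda>x. x)) (indicator (plane w))"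

lemma id_hausdorff_measurable: "(\<lambda>x. x) \<in> hausdorff_measure d \<rightarrow>\<^sub>M borel"
  using borel_subset_hausdorff_sets[of d] by (auto simp: measurable_def)

lemma sets_hausdorff_plane [simp, measurable_cong]: "sets (hausdorff_plane w) = sets borel"
  by (simp add: hausdorff_plane_def)

lemma nn_integral_hausdorff_plane:
  assumes [measurable]: "f \<in> borel_measurable borel"
  shows "(\<integral>\<^sup>+x. f x \<partial>hausdorff_plane w) = (\<integral>\<^sup>+x. indicator (plane w) x * f x \<partial>hausdorff_measure (dim E + 1))"
  unfolding hausdorff_plane_def
  by (subst nn_integral_density) (simp_all add: nn_integral_distr id_hausdorff_measurable)

lemma emeasure_hausdorff_plane:
  assumes [measurable]: "A \<in> sets borel"
  shows "emeasure (hausdorff_plane w) A = hausdorff_outer (dim E + 1) (A \<inter> plane w)"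
proof -
  have m: "A \<inter> plane w \<in> sets (hausdorff_measure (dim E + 1))"
    by (rule subsetD[OF borel_subset_hausdorff_sets]) measurable
  have "emeasure (hausdorff_plane w) A = (\<integral>\<^sup>+x. indicator A x \<partial>hausdorff_plane w)"
    by simp
  also have "\<dots> = (\<integral>\<^sup>+x. indicator (A \<inter> plane w) x \<partial>hausdorff_measure (dim E + 1))"
    by (subst nn_integral_hausdorff_plane) (auto simp: indicator_def intro!: nn_integral_cong)
  also have "\<dots> = hausdorff_outer (dim E + 1) (A \<inter> plane w)"
    using m by (simp add: emeasure_hausdorff_measure)
  finally show ?thesis .
qed

lemma sigma_finite_hausdorff_plane:
  assumes "w \<in> E\<^sup>\<bottom>" "w \<noteq> 0"
  shows "sigma_finite_measure (hausdorff_plane w)"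
proof
  let ?A = "range (\<lambda>R::nat. cball (0::'a) (real R))"
  have "emeasure (hausdorff_plane w) (cball 0 (real R)) \<noteq> \<infinity>" for R
    using hausdorff_outer_bounded_subspace_finite[OF plane_subspace[of w], of "dim E + 1" R]
      dim_plane[OF assms]
    by (simp add: emeasure_hausdorff_plane Int_commute less_top[symmetric])
  moreover have "\<exists>R::nat. norm x \<le> real R" for x :: 'a by (rule real_arch_simple)
  ultimately show "\<exists>A. countable A \<and> A \<subseteq> sets (hausdorff_plane w) \<and> \<Union>A = space (hausdorff_plane w)
      \<and> (\<forall>a\<in>A. emeasure (hausdorff_plane w) a \<noteq> \<infinity>)"
    by (intro exI[of _ ?A]) (auto simp: sets_eq_imp_space_eq[OF sets_hausdorff_plane])
qed

lemma nn_integral_hausdorff_plane_translate: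
  assumes [measurable]: "f \<in> borel_measurable borel" and v: "v \<in> plane w"
  shows "(\<integral>\<^sup>+x. f (x + v) \<partial>hausdorff_plane w) = (\<integral>\<^sup>+x. f x \<partial>hausdorff_plane w)"
proof -
  have "distr (hausdorff_plane w) borel (\<lambda>x. x + v) = hausdorff_plane w"
  proof (rule measure_eqI)
    fix A assume "A \<in> sets (distr (hausdorff_plane w) borel (\<lambda>x. x + v))"
    then have [measurable]: "A \<in> sets borel" by simp
    have "emeasure (distr (hausdorff_plane w) borel (\<lambda>x. x + v)) A
        = emeasure (hausdorff_plane w) ((\<lambda>x. x + v) -` A \<inter> space (hausdorff_plane w))"
      by (rule emeasure_distr) auto
    also have "\<dots> = emeasure (hausdorff_plane w) ((\<lambda>x. x + v) -` A)"
      by (simp add: sets_eq_imp_space_eq[OF sets_hausdorff_plane])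
    also have "\<dots> = hausdorff_outer (dim E + 1) ((\<lambda>x. x + v) -` A \<inter> plane w)"
      using measurable_sets[of "\<lambda>x. x + v" borel borel A] by (intro emeasure_hausdorff_plane) auto
    also have "\<dots> = hausdorff_outer (dim E + 1) ((\<lambda>x. x + v) ` ((\<lambda>x. x + v) -` A \<inter> plane w))"
      by (rule hausdorff_outer_isometric_image[symmetric]) (simp add: dist_norm)
    also have "(\<lambda>x. x + v) ` ((\<lambda>x. x + v) -` A \<inter> plane w) = A \<inter> plane w"
    proof safe
      fix x assume "x \<in> A" "x \<in> plane w"
      then have "x - v \<in> plane w" "x = (x - v) + v" using v plane_subspace by (auto intro: subspace_diff)
      then show "x \<in> (\<lambda>x. x + v) ` ((\<lambda>x. x + v) -` A \<inter> plane w)" using \<open>x \<in> A\<close> by (intro image_eqI) auto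
    qed (use v plane_subspace in \<open>auto intro: subspace_add\<close>)
    also have "hausdorff_outer (dim E + 1) (A \<inter> plane w) = emeasure (hausdorff_plane w) A"
      by (simp add: emeasure_hausdorff_plane)
    finally show "emeasure (distr (hausdorff_plane w) borel (\<lambda>x. x + v)) A = emeasure (hausdorff_plane w) A" .
  qed simp
  moreover have "(\<integral>\<^sup>+x. f x \<partial>distr (hausdorff_plane w) borel (\<lambda>x. x + v)) = (\<integral>\<^sup>+x. f (x + v) \<partial>hausdorff_plane w)"
    by (intro nn_integral_distr) auto
  ultimately show ?thesis by simp
qed

lemma AE_hausdorff_plane: "AE x in hausdorff_plane w. x \<in> plane w"
  unfolding hausdorff_plane_def
  by (subst AE_density) (auto simp: indicator_def)

text \<open>The standard uniqueness argument for invariant measures. Write \<open>\<mu>\<close> and \<open>\<nu>\<close> for the two measures and \<open>Q\<close>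
for the unit ball. Then \<open>\<mu> A * \<nu> Q\<close> is the double integral of \<open>1\<^sub>A x * 1\<^sub>Q (y - x)\<close> by invariance of
\<open>\<nu>\<close>; translating \<open>x\<close> by \<open>y\<close> gives \<open>1\<^sub>A (x + y) * 1\<^sub>Q (- x)\<close> by invariance
of \<open>\<mu>\<close>, and this integrates to \<open>\<mu> Q * \<nu> A\<close> by
invariance of \<open>\<nu>\<close> and symmetry of \<open>Q\<close>.\<close>
lemma hausdorff_plane_proportional:
  assumes w: "w \<in> E\<^sup>\<bottom>" "w \<noteq> 0" and [measurable]: "A \<in> sets borel"
  shows "emeasure (hausdorff_plane w) A * emeasure (plane_measure w) (ball 0 1)
    = emeasure (hausdorff_plane w) (ball 0 1) * emeasure (plane_measure w) A"
proof -
  let ?\<mu> = "hausdorff_plane w" and ?\<nu> = "plane_measure w" and ?Q = "ball (0::'a) 1"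
  interpret \<mu>: sigma_finite_measure ?\<mu> by (rule sigma_finite_hausdorff_plane[OF w])
  interpret P: pair_sigma_finite ?\<mu> "lborel :: ('a \<times> real) measure" by standard
  have [simp, measurable_cong]: "sets ?\<nu> = sets borel" by (simp add: plane_measure_def)
  have neg: "- x \<in> plane w" if "x \<in> plane w" for x using that plane_subspace by (rule subspace_neg[rotated])
  define s where "s = (\<lambda>z::'a\<times>real. indicator tube (fst z) :: ennreal)"
  have [measurable]: "s \<in> borel_measurable borel"
    unfolding s_def borel_prod[symmetric] by measurable
  define q where "q = (indicator ?Q :: 'a \<Rightarrow> ennreal)"
  have [measurable]: "q \<in> borel_measurable borel"
    unfolding q_def by (intro borel_measurable_indicator) simp
  have meas: "(\<lambda>(x, z). indicator A x * (s z * q (embed w z - x))) \<in> borel_measurable (?\<mu> \<Otimes>\<^sub>M lborel)"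
    "(\<lambda>(x, z). indicator A (x + embed w z) * (s z * q (- x))) \<in> borel_measurable (?\<mu> \<Otimes>\<^sub>M lborel)"
    by measurable
  have "emeasure ?\<mu> A * emeasure ?\<nu> ?Q = (\<integral>\<^sup>+x. indicator A x * emeasure ?\<nu> ?Q \<partial>?\<mu>)"
    by (simp add: nn_integral_multc)
  also have "\<dots> = (\<integral>\<^sup>+x. indicator A x * (\<integral>\<^sup>+z. s z * q (embed w z - x) \<partial>lborel) \<partial>?\<mu>)"
  proof (rule nn_integral_cong_AE, use AE_hausdorff_plane in eventually_elim)
    fix x assume "x \<in> plane w"
    then have "(\<integral>\<^sup>+y. q (y + (- x)) \<partial>?\<nu>) = (\<integral>\<^sup>+y. q y \<partial>?\<nu>)"
      by (intro nn_integral_plane_measure_translate neg) auto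
    also have "\<dots> = emeasure ?\<nu> ?Q" by (simp add: q_def)
    finally have "(\<integral>\<^sup>+y. q (y + (- x)) \<partial>?\<nu>) = emeasure ?\<nu> ?Q" .
    then show "indicator A x * emeasure ?\<nu> ?Q
        = indicator A x * (\<integral>\<^sup>+z. s z * q (embed w z - x) \<partial>lborel)"
      by (subst (asm) nn_integral_plane_measure) (auto simp: s_def)
  qed
  also have "\<dots> = (\<integral>\<^sup>+x. \<integral>\<^sup>+z. indicator A x * (s z * q (embed w z - x)) \<partial>lborel \<partial>?\<mu>)"
    by (intro nn_integral_cong nn_integral_cmult[symmetric]) measurable
  also have "\<dots> = (\<integral>\<^sup>+z. \<integral>\<^sup>+x. indicator A x * (s z * q (embed w z - x)) \<partial>?\<mu> \<partial>lborel)"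
    using meas(1) by (rule P.Fubini'[symmetric])
  also have "\<dots> = (\<integral>\<^sup>+z. \<integral>\<^sup>+x. indicator A (x + embed w z) * (s z * q (- x)) \<partial>?\<mu> \<partial>lborel)"
  proof (rule nn_integral_cong)
    fix z :: "'a \<times> real"
    have "(\<lambda>x. indicator A x * (s z * q (embed w z - x))) \<in> borel_measurable borel" by measurable
    from nn_integral_hausdorff_plane_translate[OF this embed_in_plane[of w z]]
    show "(\<integral>\<^sup>+x. indicator A x * (s z * q (embed w z - x)) \<partial>?\<mu>)
      = (\<integral>\<^sup>+x. indicator A (x + embed w z) * (s z * q (- x)) \<partial>?\<mu>)" by simp
  qed
  also have "\<dots> = (\<integral>\<^sup>+x. \<integral>\<^sup>+z. indicator A (x + embed w z) * (s z * q (- x)) \<partial>lborel \<partial>?\<mu>)"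
    using meas(2) by (rule P.Fubini')
  also have "\<dots> = (\<integral>\<^sup>+x. q x * emeasure ?\<nu> A \<partial>?\<mu>)"
  proof (rule nn_integral_cong_AE, use AE_hausdorff_plane in eventually_elim)
    fix x assume x: "x \<in> plane w"
    have "(\<integral>\<^sup>+z. indicator A (x + embed w z) * (s z * q (- x)) \<partial>lborel)
        = (\<integral>\<^sup>+z. q x * (s z * indicator A (embed w z + x)) \<partial>lborel)"
      by (intro nn_integral_cong) (auto simp: q_def indicator_def add.commute)
    also have "\<dots> = q x * (\<integral>\<^sup>+z. s z * indicator A (embed w z + x) \<partial>lborel)"
      by (intro nn_integral_cmult) measurable
    also have "(\<integral>\<^sup>+z. s z * indicator A (embed w z + x) \<partial>lborel) = (\<integral>\<^sup>+y. indicator A (y + x) \<partial>?\<nu>)"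
      by (subst nn_integral_plane_measure) (auto simp: s_def)
    also have "\<dots> = emeasure ?\<nu> A"
      using nn_integral_plane_measure_translate[OF _ x, of "indicator A"] by simp
    finally show "(\<integral>\<^sup>+z. indicator A (x + embed w z) * (s z * q (- x)) \<partial>lborel)
        = q x * emeasure ?\<nu> A" .
  qed
  also have "\<dots> = emeasure ?\<mu> ?Q * emeasure ?\<nu> A"
    unfolding q_def by (subst nn_integral_multc) (auto intro!: borel_measurable_indicator)
  finally show ?thesis .
qed

lemma unit_cylinder_open:
  "open {z :: 'a \<times> real. fst z \<in> tube \<and> sqrt ((norm (p (fst z)))\<^sup>2 + (snd z)\<^sup>2) < 1}"
  using tube_open
  by (intro open_Collect_conj open_Collect_less continuous_intros
      continuous_on_compose2[OF p_continuous] open_vimage[OF tube_open, unfolded vimage_def]) auto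

lemma emeasure_plane_measure_ball:
  assumes "w \<in> E\<^sup>\<bottom>" "norm w = 1"
  shows "emeasure (plane_measure w) (ball 0 1)
    = emeasure lborel {z :: 'a \<times> real. fst z \<in> tube \<and> sqrt ((norm (p (fst z)))\<^sup>2 + (snd z)\<^sup>2) < 1}"
proof -
  let ?D = "{z :: 'a \<times> real. fst z \<in> tube \<and> sqrt ((norm (p (fst z)))\<^sup>2 + (snd z)\<^sup>2) < 1}"
  have [measurable]: "?D \<in> sets borel"
    using unit_cylinder_open by simp
  have "emeasure (plane_measure w) (ball 0 1) = (\<integral>\<^sup>+x. indicator (ball 0 1) x \<partial>plane_measure w)"
    by (intro nn_integral_indicator[symmetric]) (simp add: plane_measure_def)
  also have "\<dots> = (\<integral>\<^sup>+z. indicator tube (fst z) * indicator (ball 0 1) (embed w z) \<partial>lborel)"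
    by (intro nn_integral_plane_measure borel_measurable_indicator) simp
  also have "\<dots> = (\<integral>\<^sup>+z. indicator ?D z \<partial>lborel)"
    by (intro nn_integral_cong)
       (auto simp: embed_def norm_plane[OF assms p_in] indicator_def simp del: real_sqrt_lt_1_iff)
  also have "\<dots> = emeasure lborel ?D" by (rule nn_integral_indicator) measurable
  finally show ?thesis .
qed

lemma unit_cylinder_measure:
  "emeasure lborel {z :: 'a \<times> real. fst z \<in> tube \<and> sqrt ((norm (p (fst z)))\<^sup>2 + (snd z)\<^sup>2) < 1} \<notin> {0, \<infinity>}"
    (is "emeasure lborel ?D \<notin> _")
proof -
  have "open ?D" by (rule unit_cylinder_open)
  moreover have "0 \<in> ?D" using p_scale[of 0 0] by (simp add: tube_def)
  ultimately have "\<not> negligible ?D" using open_not_negligible by blast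
  then have "emeasure lborel ?D \<noteq> 0"
    using \<open>open ?D\<close> by (simp add: negligible_iff_emeasure0 )
  moreover have "bounded ?D"
  proof (rule boundedI)
    fix z assume z: "z \<in> ?D"
    have "norm (p (fst z)) \<le> sqrt ((norm (p (fst z)))\<^sup>2 + (snd z)\<^sup>2)"
      "\<bar>snd z\<bar> \<le> sqrt ((norm (p (fst z)))\<^sup>2 + (snd z)\<^sup>2)"
      by (auto intro: real_le_rsqrt)
    moreover have "sqrt ((norm (p (fst z)))\<^sup>2 + (snd z)\<^sup>2) < 1" "norm (fst z - p (fst z)) < 1"
      using z by (auto simp only: tube_def mem_Collect_eq)
    moreover have "norm (fst z) \<le> norm (p (fst z)) + norm (fst z - p (fst z))" by norm
    moreover have "norm z \<le> norm (fst z) + norm (snd z)" by (metis norm_Pair_le prod.collapse)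
    ultimately show "norm z \<le> 3" unfolding real_norm_def by linarith
  qed
  then have "emeasure lborel ?D < \<infinity>" by (rule emeasure_bounded_finite)
  ultimately show ?thesis by auto
qed

text \<open>The map that fixes \<open>E\<close> and sends \<open>w\<close> to \<open>w'\<close> is an isometry between the two hyperplanes.\<close>
lemma hausdorff_outer_ball_plane_cong:
  assumes w: "w \<in> E\<^sup>\<bottom>" "norm w = 1" and w': "w' \<in> E\<^sup>\<bottom>" "norm w' = 1"
  shows "hausdorff_outer d (ball 0 1 \<inter> plane w) = hausdorff_outer d (ball 0 1 \<inter> plane w')"
proof -
  define f where "f = (\<lambda>v. p v + (v \<bullet> w) *\<^sub>R w')"
  have f: "f (e + r *\<^sub>R w) = e + r *\<^sub>R w'" if "e \<in> E" for e r
    using that w perp[OF w(1) that]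
    by (simp add: f_def p_add p_scale p_id p_perp inner_add_left norm_eq_1)
  have nf: "norm (e + r *\<^sub>R w') = norm (e + r *\<^sub>R w)" if "e \<in> E" for e r
    using that by (simp add: norm_plane[OF w] norm_plane[OF w'])
  have "f ` (ball 0 1 \<inter> plane w) = ball 0 1 \<inter> plane w'"
  proof safe
    fix v assume "v \<in> ball 0 1" "v \<in> plane w"
    then obtain e r where "v = e + r *\<^sub>R w" "e \<in> E" "norm v < 1" by (auto simp: plane_def)
    then show "f v \<in> ball 0 1" "f v \<in> plane w'"
      using f[of e r] nf[of e r] by (auto simp: plane_def)
  next
    fix v assume "v \<in> ball 0 1" "v \<in> plane w'"
    then obtain e r where v: "v = e + r *\<^sub>R w'" "e \<in> E" "norm v < 1" by (auto simp: plane_def)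
    then have "e + r *\<^sub>R w \<in> ball 0 1 \<inter> plane w"
      using nf[of e r] by (auto simp: plane_def)
    then show "v \<in> f ` (ball 0 1 \<inter> plane w)" using f[of e r] v by (metis image_eqI)
  qed
  moreover have "hausdorff_outer d (f ` (ball 0 1 \<inter> plane w)) = hausdorff_outer d (ball 0 1 \<inter> plane w)"
  proof (rule hausdorff_outer_isometric_image)
    fix x y assume "x \<in> ball 0 1 \<inter> plane w" "y \<in> ball 0 1 \<inter> plane w"
    then obtain e r e' r' where xy: "x = e + r *\<^sub>R w" "e \<in> E" "y = e' + r' *\<^sub>R w" "e' \<in> E"
      by (auto simp: plane_def)
    have d: "f x - f y = (e - e') + (r - r') *\<^sub>R w'" "x - y = (e - e') + (r - r') *\<^sub>R w"
      using xy f by (auto simp: algebra_simps)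
    then show "dist (f x) (f y) = dist x y"
      by (simp only: dist_norm d nf[OF subspace_diff[OF sub xy(2,4)]])
  qed
  ultimately show ?thesis by simp
qed

lemma hausdorff_plane_eq_scale:
  obtains c where "c < \<infinity>"
    "\<And>w. w \<in> E\<^sup>\<bottom> \<Longrightarrow> norm w = 1 \<Longrightarrow> hausdorff_plane w = scale_measure c (plane_measure w)"
proof (cases "\<exists>w. w \<in> E\<^sup>\<bottom> \<and> norm w = 1")
  case False
  then show ?thesis using that[of 0] by auto
next
  case True
  then obtain w0 where w0: "w0 \<in> E\<^sup>\<bottom>" "norm w0 = 1" by blast
  define N where "N = emeasure lborel {z :: 'a \<times> real. fst z \<in> tube \<and> sqrt ((norm (p (fst z)))\<^sup>2 + (snd z)\<^sup>2) < 1}"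
  define Q where "Q = hausdorff_outer (dim E + 1) (ball 0 1 \<inter> plane w0)"
  have N: "N \<noteq> 0" "N \<noteq> \<infinity>" using unit_cylinder_measure by (auto simp: N_def)
  have "Q \<le> hausdorff_outer (dim E + 1) (plane w0 \<inter> cball 0 (real 1))"
    unfolding Q_def by (intro hausdorff_outer_mono) auto
  also have "\<dots> < \<infinity>"
    using w0 by (intro hausdorff_outer_bounded_subspace_finite plane_subspace dim_plane) auto
  finally have Q: "Q < \<infinity>" .
  show ?thesis
  proof (rule that[of "Q / N"])
    show "Q / N < \<infinity>" using Q N by (cases Q; cases N) (auto simp: divide_ennreal)
    fix w assume w: "w \<in> E\<^sup>\<bottom>" "norm w = 1"
    show "hausdorff_plane w = scale_measure (Q / N) (plane_measure w)"
    proof (rule measure_eqI)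
      show "sets (hausdorff_plane w) = sets (scale_measure (Q / N) (plane_measure w))"
        by (simp add: plane_measure_def)
      fix A assume "A \<in> sets (hausdorff_plane w)"
      then have [measurable]: "A \<in> sets borel" by simp
      have "w \<noteq> 0" using w by auto
      have "emeasure (hausdorff_plane w) (ball 0 1) = Q"
        unfolding Q_def hausdorff_outer_ball_plane_cong[OF w0 w] by (intro emeasure_hausdorff_plane) simp
      then have "emeasure (hausdorff_plane w) A * N = Q * emeasure (plane_measure w) A"
        using hausdorff_plane_proportional[OF w(1) \<open>w \<noteq> 0\<close> \<open>A \<in> sets borel\<close>]
        by (simp only: emeasure_plane_measure_ball[OF w] N_def)
      moreover have "emeasure (hausdorff_plane w) A = emeasure (hausdorff_plane w) A * N / N"
        using N by (simp add: ennreal_mult_divide_eq)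
      ultimately have "emeasure (hausdorff_plane w) A = Q * emeasure (plane_measure w) A / N"
        by simp
      then show "emeasure (hausdorff_plane w) A = emeasure (scale_measure (Q / N) (plane_measure w)) A"
        by (simp add: ennreal_times_divide ennreal_divide_times mult.commute)
    qed
  qed
qed

text \<open>The factor \<open>norm x\<close> arises because \<open>r\<close> counts multiples of \<open>x\<close>, not of the unit vector in its direction.\<close>
lemma nn_integral_hausdorff_plane_eq:
  obtains c where "c < \<infinity>"
    "\<And>x f. x \<in> E\<^sup>\<bottom> \<Longrightarrow> x \<noteq> 0 \<Longrightarrow> f \<in> borel_measurable borel \<Longrightarrow>
      (\<integral>\<^sup>+v. indicator (plane x) v * f v \<partial>hausdorff_measure (dim E + 1))
      = c * ennreal (norm x) * (\<integral>\<^sup>+r. \<integral>\<^sup>+y. indicator tube y * f (p y + r *\<^sub>R x) \<partial>lborel \<partial>lborel)"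
proof -
  obtain c where c: "c < \<infinity>"
    "\<And>w. w \<in> E\<^sup>\<bottom> \<Longrightarrow> norm w = 1 \<Longrightarrow> hausdorff_plane w = scale_measure c (plane_measure w)"
    using hausdorff_plane_eq_scale by blast
  show ?thesis
  proof (rule that[OF c(1)])
    fix x and f :: "'a \<Rightarrow> ennreal"
    assume x: "x \<in> E\<^sup>\<bottom>" "x \<noteq> 0" and [measurable]: "f \<in> borel_measurable borel"
    define w where "w = x /\<^sub>R norm x"
    have w: "w \<in> E\<^sup>\<bottom>" "norm w = 1"
      using x subspace_orthogonal_comp[of E] by (auto simp: w_def subspace_scale)
    have xw: "x = norm x *\<^sub>R w" using x by (simp add: w_def)
    have "plane x = plane w" using plane_scale[of "norm x" w] x xw by simp
    then have "(\<integral>\<^sup>+v. indicator (plane x) v * f v \<partial>hausdorff_measure (dim E + 1)) = (\<integral>\<^sup>+v. f v \<partial>hausdorff_plane w)"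
      by (simp add: nn_integral_hausdorff_plane)
    also have "\<dots> = c * (\<integral>\<^sup>+v. f v \<partial>plane_measure w)"
      unfolding c(2)[OF w] by (rule nn_integral_scale_measure) (simp add: plane_measure_def)
    also have "(\<integral>\<^sup>+v. f v \<partial>plane_measure w) = (\<integral>\<^sup>+z. indicator tube (fst z) * f (embed w z) \<partial>lborel)"
      by (rule nn_integral_plane_measure) measurable
    also have "\<dots> = (\<integral>\<^sup>+r. \<integral>\<^sup>+y. indicator tube y * f (p y + r *\<^sub>R w) \<partial>lborel \<partial>lborel)"
    proof -
      have "(\<lambda>(y, r). indicator tube y * f (p y + r *\<^sub>R w)) \<in> borel_measurable (lborel \<Otimes>\<^sub>M lborel)"
        by measurable
      from lborel_pair.nn_integral_snd[OF this] show ?thesis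
        by (simp add: lborel_prod embed_def case_prod_beta')
    qed
    also have "\<dots> = ennreal \<bar>norm x\<bar> * (\<integral>\<^sup>+r. \<integral>\<^sup>+y. indicator tube y * f (p y + (0 + norm x * r) *\<^sub>R w) \<partial>lborel \<partial>lborel)"
      using x by (intro nn_integral_real_affine) measurable
    also have "\<dots> = ennreal (norm x) * (\<integral>\<^sup>+r. \<integral>\<^sup>+y. indicator tube y * f (p y + r *\<^sub>R x) \<partial>lborel \<partial>lborel)"
    proof -
      have "(0 + norm x * r) *\<^sub>R w = r *\<^sub>R x" for r
        using x by (simp add: w_def)
      then show ?thesis by simp
    qed
    finally show "(\<integral>\<^sup>+v. indicator (plane x) v * f v \<partial>hausdorff_measure (dim E + 1))
      = c * ennreal (norm x) * (\<integral>\<^sup>+r. \<integral>\<^sup>+y. indicator tube y * f (p y + r *\<^sub>R x) \<partial>lborel \<partial>lborel)"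
      by (simp add: mult.assoc)
  qed
qed

end

text \<open>The sum of the components along an orthonormal basis of \<open>E\<close>.\<close>
lemma orthogonal_projection_exists:
  fixes E :: "'a::euclidean_space set"
  assumes "subspace E"
  obtains p where "orthogonal_projection E p"
proof -
  obtain B where B: "B \<subseteq> E" "pairwise orthogonal B" "\<And>b. b \<in> B \<Longrightarrow> norm b = 1"
      "independent B" "span B = E"
    using orthonormal_basis_subspace[OF assms] by metis
  have fin: "finite B" using B(4) independent_imp_finite by blast
  define p where "p = (\<lambda>x. \<Sum>b\<in>B. (x \<bullet> b) *\<^sub>R b)"
  have "orthogonal_projection E p"
  proof (rule orthogonal_projection.intro)
    show "linear p"
      unfolding p_def by (rule linearI) (simp_all add: inner_add_left scaleR_add_left sum.distrib scaleR_sum_right)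
    show "p x \<in> E" for x
      unfolding p_def using B(1) assms by (intro subspace_sum subspace_scale) auto
    show "p x = x" if "x \<in> E" for x
      unfolding p_def using orthonormal_basis_expand[OF B(2,3) _ fin] that B(5) by blast
    show "p x = 0" if "x \<in> E\<^sup>\<bottom>" for x
      unfolding p_def using that B(1) by (intro sum.neutral) (auto simp: orthogonal_comp_def orthogonal_def inner_commute)
  qed (rule assms)
  then show ?thesis using that by blast
qed

section \<open>Log-concave densities on half-spaces\<close>

lemma convex_ereal_real:
  assumes "convex_ereal \<psi>" "\<psi> x \<noteq> \<infinity>" "\<psi> y \<noteq> \<infinity>" "0 \<le> t" "t \<le> 1"
  shows "\<psi> ((1 - t) *\<^sub>R x + t *\<^sub>R y) \<noteq> \<infinity>"
    "real_of_ereal (\<psi> ((1 - t) *\<^sub>R x + t *\<^sub>R y)) \<le> (1 - t) * real_of_ereal (\<psi> x) + t * real_of_ereal (\<psi> y)"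
proof -
  obtain a b where ab: "\<psi> x = ereal a" "\<psi> y = ereal b"
    using assms by (cases "\<psi> x"; cases "\<psi> y") (auto simp: convex_ereal_def)
  have "\<psi> ((1 - t) *\<^sub>R x + t *\<^sub>R y) \<noteq> -\<infinity>"
    "\<psi> ((1 - t) *\<^sub>R x + t *\<^sub>R y) \<le> ereal (1 - t) * \<psi> x + ereal t * \<psi> y"
    using assms by (auto simp: convex_ereal_def)
  then show "\<psi> ((1 - t) *\<^sub>R x + t *\<^sub>R y) \<noteq> \<infinity>"
    "real_of_ereal (\<psi> ((1 - t) *\<^sub>R x + t *\<^sub>R y)) \<le> (1 - t) * real_of_ereal (\<psi> x) + t * real_of_ereal (\<psi> y)"
    unfolding ab by (cases "\<psi> ((1 - t) *\<^sub>R x + t *\<^sub>R y)"; simp)+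
qed

lemma half_space_subset_plane: "half_space E x \<subseteq> {e + r *\<^sub>R x |e r. e \<in> E}"
  by (auto simp: half_space_def)

context orthogonal_projection
begin

lemma p_p [simp]: "p (p x) = p x" by (rule p_id[OF p_in])

definition domain :: "('a \<Rightarrow> ereal) \<Rightarrow> 'a \<Rightarrow> ('a \<times> real) set" where
  "domain \<psi> x = {z. \<psi> (embed x z) \<noteq> \<infinity>}"

text \<open>Leaving out height zero and the frontier of the domain of finiteness makes this set open for relatively
open \<open>K\<close>, and affects the density on \<open>K\<close> only on a null set.\<close>
definition cell :: "('a \<Rightarrow> ereal) \<Rightarrow> 'a \<Rightarrow> 'a set \<Rightarrow> ('a \<times> real) set" where
  "cell \<psi> x K = interior (domain \<psi> x) \<inter> {z. 0 < snd z \<and> embed x z \<in> K}"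

definition density_on :: "('a \<Rightarrow> ereal) \<Rightarrow> 'a \<Rightarrow> 'a set \<Rightarrow> 'a \<times> real \<Rightarrow> ennreal" where
  "density_on \<psi> x K z = ennreal (indicator (cell \<psi> x K) z *\<^sub>R exp (- real_of_ereal (\<psi> (embed x z))))"

lemma embed_convex: "embed x ((1 - t) *\<^sub>R z + t *\<^sub>R z') = (1 - t) *\<^sub>R embed x z + t *\<^sub>R embed x z'"
  by (simp add: embed_def p_add p_scale scaleR_add_left scaleR_add_right)

lemma embed_continuous: "continuous_on UNIV (embed x)"
  unfolding embed_def
  by (intro continuous_intros continuous_on_compose2[OF p_continuous]) auto

lemma embed_p: "embed x (p (fst z), snd z) = embed x z"
  by (simp add: embed_def)

lemma convex_domain:
  assumes "convex_ereal \<psi>"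
  shows "convex (domain \<psi> x)"
  unfolding convex_alt domain_def
  using convex_ereal_real(1)[OF assms] by (auto simp: embed_convex)

lemma convex_on_domain:
  assumes "convex_ereal \<psi>"
  shows "convex_on (domain \<psi> x) (\<lambda>z. real_of_ereal (\<psi> (embed x z)))"
proof (rule convex_onI)
  fix t :: real and z z' assume "0 < t" "t < 1" "z \<in> domain \<psi> x" "z' \<in> domain \<psi> x"
  then show "real_of_ereal (\<psi> (embed x ((1 - t) *\<^sub>R z + t *\<^sub>R z')))
    \<le> (1 - t) * real_of_ereal (\<psi> (embed x z)) + t * real_of_ereal (\<psi> (embed x z'))"
    unfolding embed_convex by (intro convex_ereal_real(2)[OF assms]) (auto simp: domain_def)
qed (rule convex_domain[OF assms])

text \<open>The first coordinate matters only through its projection. For interiors and closures this is seen from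
invariance under the translations that \<open>embed x\<close> sends to zero.\<close>
lemma translation_invariant_p:
  assumes "\<And>a. embed x a = 0 \<Longrightarrow> (+) a ` S = S"
  shows "(p (fst z), snd z) \<in> S \<longleftrightarrow> z \<in> S"
proof -
  have "embed x (p (fst z) - fst z, 0) = 0" "embed x (fst z - p (fst z), 0) = 0"
    by (simp_all add: embed_def p_diff)
  from this[THEN assms] show ?thesis
    by (cases z) force
qed

lemma domain_translation:
  assumes "embed x a = 0"
  shows "(+) a ` domain \<psi> x = domain \<psi> x"
proof (intro equalityI subsetI)
  fix v assume "v \<in> domain \<psi> x"
  moreover have "embed x (v - a) = embed x v"
    using embed_add[of x "v - a" a] assms by simp
  ultimately show "v \<in> (+) a ` domain \<psi> x"
    by (intro image_eqI[of _ _ "v - a"]) (auto simp: domain_def)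
qed (auto simp: domain_def embed_add assms)

lemma interior_domain_p: "(p (fst z), snd z) \<in> interior (domain \<psi> x) \<longleftrightarrow> z \<in> interior (domain \<psi> x)"
  by (rule translation_invariant_p[of x]) (simp add: domain_translation flip: interior_translation)

lemma closure_domain_p: "(p (fst z), snd z) \<in> closure (domain \<psi> x) \<longleftrightarrow> z \<in> closure (domain \<psi> x)"
  by (rule translation_invariant_p[of x]) (simp add: domain_translation flip: closure_translation)

lemma open_cell:
  assumes "openin (top_of_set (half_space E x)) K"
  shows "open (cell \<psi> x K)"
proof -
  obtain O' where O': "open O'" "K = half_space E x \<inter> O'"
    using assms by (auto simp: openin_open)
  have "{z. 0 < snd z \<and> embed x z \<in> K} = {z. 0 < snd z} \<inter> embed x -` O'"
    unfolding O'(2) half_space_def embed_def using p_in by force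
  moreover have "open {z :: 'a \<times> real. 0 < snd z}"
    by (intro open_Collect_less continuous_intros)
  moreover have "open (embed x -` O')"
    using O'(1) embed_continuous by (rule open_vimage)
  ultimately show ?thesis unfolding cell_def by auto
qed

lemma density_on_measurable:
  assumes "convex_ereal \<psi>" "openin (top_of_set (half_space E x)) K"
  shows "density_on \<psi> x K \<in> borel_measurable borel"
proof -
  have "convex_on (interior (domain \<psi> x)) (\<lambda>z. real_of_ereal (\<psi> (embed x z)))"
    by (rule convex_on_subset[OF convex_on_domain[OF assms(1)] interior_subset convex_interior[OF convex_domain[OF assms(1)]]])
  then have "continuous_on (interior (domain \<psi> x)) (\<lambda>z. real_of_ereal (\<psi> (embed x z)))"
    by (intro convex_on_continuous) auto
  then have "continuous_on (cell \<psi> x K) (\<lambda>z. exp (- real_of_ereal (\<psi> (embed x z))))"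
    by (intro continuous_intros) (rule continuous_on_subset, auto simp: cell_def)
  then have "(\<lambda>z. indicator (cell \<psi> x K) z *\<^sub>R exp (- real_of_ereal (\<psi> (embed x z)))) \<in> borel_measurable borel"
    using open_cell[OF assms(2)] by (intro borel_measurable_continuous_on_indicator) auto
  then show ?thesis unfolding density_on_def by measurable
qed

lemma density_on_p: "density_on \<psi> x K (p (fst z), snd z) = density_on \<psi> x K z"
  by (simp add: density_on_def cell_def indicator_def embed_p interior_domain_p)

definition section_integral :: "('a \<Rightarrow> ereal) \<Rightarrow> 'a \<Rightarrow> 'a set \<Rightarrow> real \<Rightarrow> ennreal" where
  "section_integral \<psi> x K r = (\<integral>\<^sup>+y. indicator tube y * density_on \<psi> x K (y, r) \<partial>lborel)"

lemma section_integral_measurable: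
  assumes "convex_ereal \<psi>" "openin (top_of_set (half_space E x)) K"
  shows "section_integral \<psi> x K \<in> borel_measurable borel"
proof -
  have [measurable]: "density_on \<psi> x K \<in> borel_measurable (borel \<Otimes>\<^sub>M borel)"
    using density_on_measurable[OF assms] by (simp add: borel_prod)
  show ?thesis unfolding section_integral_def by measurable
qed

lemma section_integral_nonpos: "r \<le> 0 \<Longrightarrow> section_integral \<psi> x K r = 0"
  by (auto simp: section_integral_def density_on_def cell_def)

text \<open>For nonzero \<open>x\<close> orthogonal to \<open>E\<close>, the coordinates of a point of \<open>plane x\<close> whose first component lies
in \<open>E\<close>; the map \<open>embed x\<close> itself is not injective.\<close>
definition coord :: "'a \<Rightarrow> 'a \<Rightarrow> 'a \<times> real" where
  "coord x v = (p v, (v \<bullet> x) / (norm x)\<^sup>2)"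

lemma coord_embed:
  assumes "x \<in> E\<^sup>\<bottom>" "x \<noteq> 0"
  shows "coord x (embed x z) = (p (fst z), snd z)"
  using perp[OF assms(1) p_in[of "fst z"]] assms
  by (simp add: coord_def embed_def p_add p_scale p_perp inner_add_left power2_norm_eq_inner)

lemma coord_measurable: "coord x \<in> borel \<rightarrow>\<^sub>M borel"
  unfolding coord_def borel_prod[symmetric] by measurable

text \<open>Off the set \<open>Z\<close>, where the height vanishes or the coordinates lie on the frontier of the domain of
finiteness, the density restricted to \<open>K\<close> agrees with the Borel function \<open>density_on \<psi> x K\<close> read in
coordinates. The set \<open>Z\<close> is null since hyperplanes and frontiers of convex sets are negligible.\<close>
lemma nn_integral_hausdorff_half_space:
  assumes \<psi>: "convex_ereal \<psi>" and K: "openin (top_of_set (half_space E x)) K"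
    and x: "x \<in> E\<^sup>\<bottom>" "x \<noteq> 0"
    and c: "\<And>f. f \<in> borel_measurable borel \<Longrightarrow>
      (\<integral>\<^sup>+v. indicator (plane x) v * f v \<partial>hausdorff_measure (dim E + 1))
      = c * ennreal (norm x) * (\<integral>\<^sup>+r. \<integral>\<^sup>+y. indicator tube y * f (p y + r *\<^sub>R x) \<partial>lborel \<partial>lborel)"
  shows "(\<integral>\<^sup>+v\<in>K. ennreal (exp_minus (\<psi> v)) \<partial>hausdorff_measure (dim E + 1))
    = c * ennreal (norm x) * (\<integral>\<^sup>+r. section_integral \<psi> x K r * indicator {0<..} r \<partial>lborel)"
proof -
  let ?H = "hausdorff_measure (dim E + 1) :: 'a measure"
  define N where "N = frontier (domain \<psi> x) \<union> {z. snd z = 0}"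
  define Z where "Z = plane x \<inter> coord x -` N"
  have "negligible {z :: 'a \<times> real. (0, 1) \<bullet> z = 0}"
    by (rule negligible_hyperplane) (simp add: zero_prod_def)
  then have negl: "negligible N"
    unfolding N_def using negligible_convex_frontier[OF convex_domain[OF \<psi>]]
    by (intro negligible_Un) (auto simp: inner_prod_def)
  have "closed N"
    unfolding N_def by (intro closed_Un frontier_closed closed_Collect_eq continuous_intros)
  then have N [measurable]: "N \<in> sets borel" by simp
  have N0: "emeasure lborel N = 0"
    using negl N by (simp add: negligible_iff_emeasure0)
  have [measurable]: "coord x -` N \<in> sets borel"
    using measurable_sets[OF coord_measurable N] by simp
  then have Zb: "Z \<in> sets borel" unfolding Z_def by measurable
  have embedN: "(p y, r) \<in> N \<longleftrightarrow> (y, r) \<in> N" for y r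
    using interior_domain_p[of "(y, r)"] closure_domain_p[of "(y, r)"] by (auto simp: N_def frontier_def)
  have "emeasure ?H Z = (\<integral>\<^sup>+v. indicator (plane x) v * indicator (coord x -` N) v \<partial>?H)"
  proof -
    have "indicator (plane x) v * indicator (coord x -` N) v = (indicator Z v :: ennreal)" for v
      by (auto simp: Z_def indicator_def)
    then show ?thesis
      using subsetD[OF borel_subset_hausdorff_sets Zb] by simp
  qed
  also have "\<dots> = c * ennreal (norm x) * (\<integral>\<^sup>+r. \<integral>\<^sup>+y. indicator tube y * indicator (coord x -` N) (p y + r *\<^sub>R x) \<partial>lborel \<partial>lborel)"
    by (rule c) measurable
  also have "(\<integral>\<^sup>+r. \<integral>\<^sup>+y. indicator tube y * indicator (coord x -` N) (p y + r *\<^sub>R x) \<partial>lborel \<partial>lborel)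
      \<le> (\<integral>\<^sup>+r. \<integral>\<^sup>+y. indicator N (y, r) \<partial>lborel \<partial>lborel)"
    using coord_embed[OF x] embedN
    by (intro nn_integral_mono) (auto simp: indicator_def embed_def)
  also have "(\<integral>\<^sup>+r. \<integral>\<^sup>+y. indicator N (y, r) \<partial>lborel \<partial>lborel) = (\<integral>\<^sup>+z. indicator N z \<partial>(lborel \<Otimes>\<^sub>M lborel))"
    using lborel_pair.nn_integral_snd[of "indicator N"] by (simp add: lborel_prod)
  also have "\<dots> = 0" by (simp add: lborel_prod N0)
  finally have Z0: "emeasure ?H Z = 0" by (simp add: mult_left_mono)
  have AE: "AE v in ?H. v \<notin> Z"
    using Zb Z0 borel_subset_hausdorff_sets[where 'a='a] by (intro AE_not_in) (auto simp: null_sets_def)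
  have "(\<integral>\<^sup>+v\<in>K. ennreal (exp_minus (\<psi> v)) \<partial>?H) = (\<integral>\<^sup>+v. indicator (plane x) v * density_on \<psi> x K (coord x v) \<partial>?H)"
  proof (rule nn_integral_cong_AE, use AE in eventually_elim)
    fix v assume v: "v \<notin> Z"
    show "ennreal (exp_minus (\<psi> v)) * indicator K v = indicator (plane x) v * density_on \<psi> x K (coord x v)"
    proof (cases "v \<in> plane x")
      case True
      then obtain e r where er: "e \<in> E" "v = embed x (e, r)" by (auto simp: plane_def embed_def p_id)
      have co: "coord x v = (e, r)" using er coord_embed[OF x, of "(e, r)"] by (simp add: p_id)
      have nN: "(e, r) \<notin> N" using v True co by (simp add: Z_def)
      have "0 \<le> r" if "v \<in> K"
      proof -
        have "v \<in> half_space E x" using that K openin_imp_subset by blast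
        then obtain e' r' where "e' \<in> E" "0 \<le> r'" "v = embed x (e', r')" by (auto simp: half_space_def embed_def p_id)
        then show ?thesis using co coord_embed[OF x, of "(e', r')"] by simp
      qed
      then have cell: "(e, r) \<in> cell \<psi> x K \<longleftrightarrow> v \<in> K \<and> \<psi> v \<noteq> \<infinity>"
        using nN er interior_subset[of "domain \<psi> x"] closure_subset[of "domain \<psi> x"]
        by (force simp: cell_def N_def frontier_def domain_def)
      have "density_on \<psi> x K (e, r) = ennreal (exp_minus (\<psi> v)) * indicator K v"
        using cell by (auto simp: density_on_def exp_minus_def indicator_def er(2)[symmetric])
      then show ?thesis
        using True co by simp
    next
      case False
      moreover have "K \<subseteq> plane x" using openin_imp_subset[OF K] half_space_subset_plane[of E x] by (auto simp: plane_def)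
      ultimately show ?thesis by (auto simp: indicator_def)
    qed
  qed
  also have "\<dots> = c * ennreal (norm x) * (\<integral>\<^sup>+r. \<integral>\<^sup>+y. indicator tube y * density_on \<psi> x K (coord x (p y + r *\<^sub>R x)) \<partial>lborel \<partial>lborel)"
    by (rule c) (intro measurable_compose[OF coord_measurable density_on_measurable[OF \<psi> K]])
  also have "(\<integral>\<^sup>+r. \<integral>\<^sup>+y. indicator tube y * density_on \<psi> x K (coord x (p y + r *\<^sub>R x)) \<partial>lborel \<partial>lborel)
      = (\<integral>\<^sup>+r. section_integral \<psi> x K r \<partial>lborel)"
    unfolding section_integral_def
  proof (intro nn_integral_cong)
    fix r y show "indicator tube y * density_on \<psi> x K (coord x (p y + r *\<^sub>R x)) = indicator tube y * density_on \<psi> x K (y, r)"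
      using coord_embed[OF x, of "(y, r)"] density_on_p[of \<psi> x K "(y, r)"] by (simp add: embed_def)
  qed
  also have "\<dots> = (\<integral>\<^sup>+r. section_integral \<psi> x K r * indicator {0<..} r \<partial>lborel)"
    by (intro nn_integral_cong) (auto simp: indicator_def section_integral_nonpos)
  finally show ?thesis .
qed

text \<open>Only membership in the interior of the domain needs an argument. Keep the second point fixed and solve
for the first: near the combined point this solution \<open>\<theta>\<close> depends continuously on it, so a whole
neighbourhood consists of combinations of a domain point over \<open>x\<^sub>0\<close> with \<open>(y\<^sub>1, r\<^sub>1)\<close>, and convexity
of \<open>\<psi>\<close> keeps \<open>\<psi>\<close> finite there.\<close>
lemma cell_combination:
  assumes \<psi>: "convex_ereal \<psi>" and l: "0 < l" "l < 1" and t: "0 < t" "t < 1"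
    and r: "0 < r" "(1 - t) * r\<^sub>0 = (1 - l) * r" "t * r\<^sub>1 = l * r"
    and x: "x\<^sub>l = (1 - l) *\<^sub>R x\<^sub>0 + l *\<^sub>R x\<^sub>1"
    and K: "{(1 - t) *\<^sub>R a + t *\<^sub>R b |a b. a \<in> K\<^sub>0 \<and> b \<in> K\<^sub>1} \<inter> half_space E x\<^sub>l \<subseteq> K\<^sub>l"
    and y: "(y\<^sub>0, r\<^sub>0) \<in> cell \<psi> x\<^sub>0 K\<^sub>0" "(y\<^sub>1, r\<^sub>1) \<in> cell \<psi> x\<^sub>1 K\<^sub>1"
  shows "embed x\<^sub>l ((1 - t) *\<^sub>R y\<^sub>0 + t *\<^sub>R y\<^sub>1, r)
      = (1 - t) *\<^sub>R embed x\<^sub>0 (y\<^sub>0, r\<^sub>0) + t *\<^sub>R embed x\<^sub>1 (y\<^sub>1, r\<^sub>1)" (is "?L = ?R")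
    and "((1 - t) *\<^sub>R y\<^sub>0 + t *\<^sub>R y\<^sub>1, r) \<in> cell \<psi> x\<^sub>l K\<^sub>l"
proof -
  have emb: "embed x\<^sub>l (y', r') = (1 - t') *\<^sub>R embed x\<^sub>0 (u, s\<^sub>0) + t' *\<^sub>R embed x\<^sub>1 (v, s\<^sub>1)"
    if "y' = (1 - t') *\<^sub>R u + t' *\<^sub>R v" "(1 - t') * s\<^sub>0 = (1 - l) * r'" "t' * s\<^sub>1 = l * r'" for y' r' u s\<^sub>0 v s\<^sub>1 t'
  proof -
    have "(1 - t') *\<^sub>R embed x\<^sub>0 (u, s\<^sub>0) + t' *\<^sub>R embed x\<^sub>1 (v, s\<^sub>1)
        = p y' + ((1 - t') * s\<^sub>0) *\<^sub>R x\<^sub>0 + (t' * s\<^sub>1) *\<^sub>R x\<^sub>1"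
      by (simp add: that(1) embed_def p_add p_scale scaleR_add_right)
    also have "\<dots> = p y' + r' *\<^sub>R x\<^sub>l"
      unfolding that(2,3) x by (simp add: scaleR_add_right mult.commute)
    finally show ?thesis by (simp add: embed_def)
  qed
  show eq: "?L = ?R" using r by (intro emb) auto
  have r1: "0 < r\<^sub>1" "(y\<^sub>1, r\<^sub>1) \<in> domain \<psi> x\<^sub>1" using y(2) interior_subset by (auto simp: cell_def)
  define U where "U = {z :: 'a \<times> real. 0 < snd z \<and> snd z < r\<^sub>1 / l}"
  \<comment> \<open>The weight of the second point, forced by the height of \<open>z\<close>.\<close>
  define \<tau> where "\<tau> = (\<lambda>z :: 'a \<times> real. l * snd z / r\<^sub>1)"
  \<comment> \<open>The first point, recovered from \<open>z\<close> and the fixed second point.\<close>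
  define \<theta> where "\<theta> = (\<lambda>z. ((1 / (1 - \<tau> z)) *\<^sub>R (fst z - \<tau> z *\<^sub>R y\<^sub>1), (1 - l) * snd z / (1 - \<tau> z)))"
  have \<tau>: "0 < \<tau> z" "\<tau> z < 1" if "z \<in> U" for z
    using that r1 l by (auto simp: U_def \<tau>_def field_simps)
  have U: "open U"
    unfolding U_def by (intro open_Collect_conj open_Collect_less continuous_intros)
  have "continuous_on U \<theta>"
    unfolding \<theta>_def using \<tau> r1(1)
    by (intro continuous_intros) (auto simp: \<tau>_def intro!: continuous_intros)
  then have op: "open (U \<inter> \<theta> -` interior (domain \<psi> x\<^sub>0))"
    using U by (intro continuous_open_preimage) auto
  have "U \<inter> \<theta> -` interior (domain \<psi> x\<^sub>0) \<subseteq> domain \<psi> x\<^sub>l"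
  proof
    fix z assume z: "z \<in> U \<inter> \<theta> -` interior (domain \<psi> x\<^sub>0)"
    then have z0: "\<theta> z \<in> domain \<psi> x\<^sub>0" using interior_subset by blast
    have "embed x\<^sub>l (fst z, snd z) = (1 - \<tau> z) *\<^sub>R embed x\<^sub>0 (fst (\<theta> z), snd (\<theta> z)) + \<tau> z *\<^sub>R embed x\<^sub>1 (y\<^sub>1, r\<^sub>1)"
      using \<tau>[of z] z r1 by (intro emb) (auto simp: \<theta>_def \<tau>_def)
    then show "z \<in> domain \<psi> x\<^sub>l"
      using convex_ereal_real(1)[OF \<psi>, of "embed x\<^sub>0 (\<theta> z)" "embed x\<^sub>1 (y\<^sub>1, r\<^sub>1)" "\<tau> z"] z0 r1(2) \<tau>[of z] z
      by (simp add: domain_def)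
  qed
  moreover have "((1 - t) *\<^sub>R y\<^sub>0 + t *\<^sub>R y\<^sub>1, r) \<in> U \<inter> \<theta> -` interior (domain \<psi> x\<^sub>0)"
  proof -
    have t\<tau>: "\<tau> ((1 - t) *\<^sub>R y\<^sub>0 + t *\<^sub>R y\<^sub>1, r) = t" using r(3) r1(1) by (simp add: \<tau>_def field_simps)
    have "(1 - l) * r / (1 - t) = r\<^sub>0" using r(2) t by (simp add: field_simps)
    then have "\<theta> ((1 - t) *\<^sub>R y\<^sub>0 + t *\<^sub>R y\<^sub>1, r) = (y\<^sub>0, r\<^sub>0)"
      using t by (simp add: \<theta>_def t\<tau>)
    moreover have "r < r\<^sub>1 / l"
    proof -
      have "l * r < r\<^sub>1" unfolding r(3)[symmetric] using t r1(1) by simp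
      then show ?thesis using l by (simp add: pos_less_divide_eq mult.commute)
    qed
    ultimately show ?thesis using y(1) r(1) by (auto simp: U_def cell_def)
  qed
  ultimately have "((1 - t) *\<^sub>R y\<^sub>0 + t *\<^sub>R y\<^sub>1, r) \<in> interior (domain \<psi> x\<^sub>l)"
    using op by (meson interiorI)
  moreover have "?L \<in> K\<^sub>l"
  proof -
    have "?L \<in> half_space E x\<^sub>l" unfolding half_space_def embed_def using p_in r(1) by force
    then show ?thesis using K y unfolding eq cell_def by blast
  qed
  ultimately show "((1 - t) *\<^sub>R y\<^sub>0 + t *\<^sub>R y\<^sub>1, r) \<in> cell \<psi> x\<^sub>l K\<^sub>l"
    using r(1) by (simp add: cell_def)
qed

text \<open>The Prekopa-Leindler inequality with weight \<open>t\<close> for the densities at heights \<open>r\<^sub>0\<close>, \<open>r\<^sub>1\<close> and \<open>r\<close>, cut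
off to the tube; the tube is convex, so the cut-off does no harm.\<close>
lemma section_integral_prekopa_leindler:
  assumes \<psi>: "convex_ereal \<psi>" and l: "0 < l" "l < 1" and t: "0 < t" "t < 1"
    and r: "0 < r" "(1 - t) * r\<^sub>0 = (1 - l) * r" "t * r\<^sub>1 = l * r"
    and x: "x\<^sub>l = (1 - l) *\<^sub>R x\<^sub>0 + l *\<^sub>R x\<^sub>1"
    and op: "openin (top_of_set (half_space E x\<^sub>0)) K\<^sub>0" "openin (top_of_set (half_space E x\<^sub>l)) K\<^sub>l"
      "openin (top_of_set (half_space E x\<^sub>1)) K\<^sub>1"
    and K: "{(1 - t) *\<^sub>R a + t *\<^sub>R b |a b. a \<in> K\<^sub>0 \<and> b \<in> K\<^sub>1} \<inter> half_space E x\<^sub>l \<subseteq> K\<^sub>l"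
  shows "mean_dom (geometric_mean t) (section_integral \<psi> x\<^sub>0 K\<^sub>0 r\<^sub>0) (section_integral \<psi> x\<^sub>1 K\<^sub>1 r\<^sub>1)
    (section_integral \<psi> x\<^sub>l K\<^sub>l r)"
  unfolding section_integral_def
proof (rule prekopa_leindler[OF t])
  have meas: "(\<lambda>y. indicator tube y * density_on \<psi> x' K' (y, r')) \<in> borel_measurable borel"
    if "openin (top_of_set (half_space E x')) K'" for x' K' r'
  proof -
    have [measurable]: "density_on \<psi> x' K' \<in> borel_measurable (borel \<Otimes>\<^sub>M borel)"
      using density_on_measurable[OF \<psi> that] by (simp add: borel_prod)
    show ?thesis by measurable
  qed
  show "(\<lambda>y. indicator tube y * density_on \<psi> x\<^sub>0 K\<^sub>0 (y, r\<^sub>0)) \<in> borel_measurable borel"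
    "(\<lambda>y. indicator tube y * density_on \<psi> x\<^sub>1 K\<^sub>1 (y, r\<^sub>1)) \<in> borel_measurable borel"
    "(\<lambda>y. indicator tube y * density_on \<psi> x\<^sub>l K\<^sub>l (y, r)) \<in> borel_measurable borel"
    using op by (auto intro: meas)
  fix y\<^sub>0 y\<^sub>1
  show "mean_dom (geometric_mean t) (indicator tube y\<^sub>0 * density_on \<psi> x\<^sub>0 K\<^sub>0 (y\<^sub>0, r\<^sub>0))
     (indicator tube y\<^sub>1 * density_on \<psi> x\<^sub>1 K\<^sub>1 (y\<^sub>1, r\<^sub>1))
     (indicator tube ((1 - t) *\<^sub>R y\<^sub>0 + t *\<^sub>R y\<^sub>1) * density_on \<psi> x\<^sub>l K\<^sub>l ((1 - t) *\<^sub>R y\<^sub>0 + t *\<^sub>R y\<^sub>1, r))"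
    unfolding mean_dom_def
  proof (intro allI impI)
    fix \<alpha> \<beta> :: real
    assume \<alpha>: "0 < \<alpha>" "ennreal \<alpha> < indicator tube y\<^sub>0 * density_on \<psi> x\<^sub>0 K\<^sub>0 (y\<^sub>0, r\<^sub>0)"
      and \<beta>: "0 < \<beta>" "ennreal \<beta> < indicator tube y\<^sub>1 * density_on \<psi> x\<^sub>1 K\<^sub>1 (y\<^sub>1, r\<^sub>1)"
    let ?y = "(1 - t) *\<^sub>R y\<^sub>0 + t *\<^sub>R y\<^sub>1"
    define a where "a = real_of_ereal (\<psi> (embed x\<^sub>0 (y\<^sub>0, r\<^sub>0)))"
    define b where "b = real_of_ereal (\<psi> (embed x\<^sub>1 (y\<^sub>1, r\<^sub>1)))"
    have A: "y\<^sub>0 \<in> tube" "(y\<^sub>0, r\<^sub>0) \<in> cell \<psi> x\<^sub>0 K\<^sub>0" "\<alpha> \<le> exp (- a)"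
    proof -
      show 1: "y\<^sub>0 \<in> tube" using \<alpha>(2) by (cases "y\<^sub>0 \<in> tube") auto
      show 2: "(y\<^sub>0, r\<^sub>0) \<in> cell \<psi> x\<^sub>0 K\<^sub>0"
        using \<alpha>(2) by (cases "(y\<^sub>0, r\<^sub>0) \<in> cell \<psi> x\<^sub>0 K\<^sub>0") (auto simp: density_on_def)
      show "\<alpha> \<le> exp (- a)" using \<alpha> 1 2 by (simp add: density_on_def a_def ennreal_less_iff)
    qed
    have B: "y\<^sub>1 \<in> tube" "(y\<^sub>1, r\<^sub>1) \<in> cell \<psi> x\<^sub>1 K\<^sub>1" "\<beta> \<le> exp (- b)"
    proof -
      show 1: "y\<^sub>1 \<in> tube" using \<beta>(2) by (cases "y\<^sub>1 \<in> tube") auto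
      show 2: "(y\<^sub>1, r\<^sub>1) \<in> cell \<psi> x\<^sub>1 K\<^sub>1"
        using \<beta>(2) by (cases "(y\<^sub>1, r\<^sub>1) \<in> cell \<psi> x\<^sub>1 K\<^sub>1") (auto simp: density_on_def)
      show "\<beta> \<le> exp (- b)" using \<beta> 1 2 by (simp add: density_on_def b_def ennreal_less_iff)
    qed
    note comb = cell_combination[OF \<psi> l t r x K A(2) B(2)]
    have "convex tube"
    proof -
      have "tube = (\<lambda>y. y - p y) -` ball 0 1" by (auto simp: tube_def)
      moreover have "linear (\<lambda>y. y - p y)" using lin by (intro linear_compose_sub linear_id[unfolded id_def])
      ultimately show ?thesis by (simp add: convex_linear_vimage)
    qed
    then have tube: "?y \<in> tube" using A(1) B(1) t by (intro convexD_alt) auto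
    have "(y\<^sub>0, r\<^sub>0) \<in> domain \<psi> x\<^sub>0" "(y\<^sub>1, r\<^sub>1) \<in> domain \<psi> x\<^sub>1"
      using A(2) B(2) interior_subset by (auto simp: cell_def)
    then have conv: "real_of_ereal (\<psi> (embed x\<^sub>l (?y, r))) \<le> (1 - t) * a + t * b"
      unfolding comb(1) a_def b_def using t by (intro convex_ereal_real(2)[OF \<psi>]) (auto simp: domain_def)
    have "geometric_mean t \<alpha> \<beta> \<le> geometric_mean t (exp (- a)) (exp (- b))"
      unfolding geometric_mean_def using A(3) B(3) \<alpha>(1) \<beta>(1) t by (intro mult_mono powr_mono2) auto
    also have "\<dots> = exp (- ((1 - t) * a + t * b))"
      by (simp add: geometric_mean_def powr_def exp_add[symmetric] algebra_simps)
    also have "\<dots> \<le> exp (- real_of_ereal (\<psi> (embed x\<^sub>l (?y, r))))" using conv by simp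
    finally show "ennreal (geometric_mean t \<alpha> \<beta>) \<le> indicator tube ?y * density_on \<psi> x\<^sub>l K\<^sub>l (?y, r)"
      using tube comb(2) by (simp add: density_on_def ennreal_leI)
  qed
qed

end

section \<open>The inequality for half-spaces\<close>

theorem theorem4p3:
  fixes n :: nat
    and \<psi> :: "'a::euclidean_space \<Rightarrow> ereal"
    and E K\<^sub>0 K\<^sub>l K\<^sub>1 :: "'a set"
    and x\<^sub>0 x\<^sub>l x\<^sub>1 :: 'a
    and l :: real
  assumes "DIM('a) = n + 2"
    and "convex_ereal \<psi>"
    and "subspace E" and "dim E = n"
    and "x\<^sub>0 \<in> E\<^sup>\<bottom>" and "x\<^sub>1 \<in> E\<^sup>\<bottom>"
    and "x\<^sub>0 \<noteq> x\<^sub>1" and "independent {x\<^sub>0, x\<^sub>1}"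
    and "0 < l" and "l < 1"
    and "x\<^sub>l = (1 - l) *\<^sub>R x\<^sub>0 + l *\<^sub>R x\<^sub>1"
    and "openin (top_of_set (half_space E x\<^sub>0)) K\<^sub>0" and "connected K\<^sub>0"
    and "openin (top_of_set (half_space E x\<^sub>l)) K\<^sub>l" and "connected K\<^sub>l"
    and "openin (top_of_set (half_space E x\<^sub>1)) K\<^sub>1" and "connected K\<^sub>1"
    and "\<And>t. 0 < t \<Longrightarrow> t < 1 \<Longrightarrow>
           {(1 - t) *\<^sub>R a + t *\<^sub>R b |a b. a \<in> K\<^sub>0 \<and> b \<in> K\<^sub>1} \<inter> half_space E x\<^sub>l \<subseteq> K\<^sub>l"
  shows "let I = (\<lambda>K. \<integral>\<^sup>+y\<in>K. ennreal (exp_minus (\<psi> y)) \<partial>hausdorff_measure (n + 1))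
         in ennreal (norm x\<^sub>l) / I K\<^sub>l
           \<le> ennreal (1 - l) * (ennreal (norm x\<^sub>0) / I K\<^sub>0)
             + ennreal l * (ennreal (norm x\<^sub>1) / I K\<^sub>1)"
proof -
  note \<psi> = assms(2) and sub = assms(3) and dim = assms(4) and x0 = assms(5) and x1 = assms(6)
    and l = assms(9,10) and xl = assms(11) and open_K = assms(12,14,16) and incl = assms(18)
  obtain p where "orthogonal_projection E p"
    using orthogonal_projection_exists[OF sub] by blast
  then interpret orthogonal_projection E p .
  have nz: "x\<^sub>0 \<noteq> 0" "x\<^sub>1 \<noteq> 0"
    using assms(8) dependent_zero by auto
  have xl_perp: "x\<^sub>l \<in> E\<^sup>\<bottom>"
    unfolding xl using x0 x1 subspace_orthogonal_comp by (intro subspace_add subspace_scale)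
  have "x\<^sub>l \<noteq> 0"
  proof
    assume "x\<^sub>l = 0"
    then have "l *\<^sub>R x\<^sub>1 = - ((1 - l) *\<^sub>R x\<^sub>0)"
      unfolding xl by (metis add.commute eq_neg_iff_add_eq_0)
    then have "(1 / l) *\<^sub>R (l *\<^sub>R x\<^sub>1) = (1 / l) *\<^sub>R (- ((1 - l) *\<^sub>R x\<^sub>0))" by simp
    then have "x\<^sub>1 = (1 / l) *\<^sub>R (- ((1 - l) *\<^sub>R x\<^sub>0))" using l by simp
    then have "x\<^sub>1 \<in> span {x\<^sub>0}" by (metis insertI1 span_base span_neg span_scale)
    then show False using assms(7,8) by (auto simp: dependent_def insert_Diff_if)
  qed
  obtain c where c: "c < \<infinity>"
    "\<And>x f. x \<in> E\<^sup>\<bottom> \<Longrightarrow> x \<noteq> 0 \<Longrightarrow> f \<in> borel_measurable borel \<Longrightarrow>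
      (\<integral>\<^sup>+v. indicator (plane x) v * f v \<partial>hausdorff_measure (dim E + 1))
      = c * ennreal (norm x) * (\<integral>\<^sup>+r. \<integral>\<^sup>+y. indicator tube y * f (p y + r *\<^sub>R x) \<partial>lborel \<partial>lborel)"
    using nn_integral_hausdorff_plane_eq by blast
  define J where "J = (\<lambda>x K. \<integral>\<^sup>+r. section_integral \<psi> x K r * indicator {0<..} r \<partial>lborel)"
  define I where "I = (\<lambda>K. \<integral>\<^sup>+y\<in>K. ennreal (exp_minus (\<psi> y)) \<partial>hausdorff_measure (n + 1))"
  have I: "I K = c * ennreal (norm x) * J x K"
    if "x \<in> E\<^sup>\<bottom>" "x \<noteq> 0" "openin (top_of_set (half_space E x)) K" for x K
    unfolding I_def J_def dim[symmetric]
    using nn_integral_hausdorff_half_space[OF \<psi> that(3,1,2) c(2)[OF that(1,2)]] .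
  have "mean_dom (harmonic_mean l) (J x\<^sub>0 K\<^sub>0) (J x\<^sub>1 K\<^sub>1) (J x\<^sub>l K\<^sub>l)"
    unfolding J_def
  proof (rule radial_inequality[OF l])
    fix r\<^sub>0 r\<^sub>1 r t :: real
    assume "0 < r" "0 < t" "t < 1" "(1 - t) * r\<^sub>0 = (1 - l) * r" "t * r\<^sub>1 = l * r"
    then show "mean_dom (geometric_mean t) (section_integral \<psi> x\<^sub>0 K\<^sub>0 r\<^sub>0) (section_integral \<psi> x\<^sub>1 K\<^sub>1 r\<^sub>1)
        (section_integral \<psi> x\<^sub>l K\<^sub>l r)"
      using \<psi> l xl open_K incl[of t] by (intro section_integral_prekopa_leindler)
  qed (use \<psi> open_K in \<open>auto intro: section_integral_measurable\<close>)
  then have J: "inverse (J x\<^sub>l K\<^sub>l) \<le> ennreal (1 - l) * inverse (J x\<^sub>0 K\<^sub>0) + ennreal l * inverse (J x\<^sub>1 K\<^sub>1)"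
    by (rule mean_dom_harmonic_inverse[OF l])
  have "ennreal (norm x\<^sub>l) / I K\<^sub>l
      \<le> ennreal (1 - l) * (ennreal (norm x\<^sub>0) / I K\<^sub>0) + ennreal l * (ennreal (norm x\<^sub>1) / I K\<^sub>1)"
  \<comment> \<open>If \<open>c = 0\<close>, all three integrals vanish and both sides are infinite.\<close>
  proof (cases "c = 0")
    case True
    then show ?thesis
      using I[OF x0 nz(1) open_K(1)] nz l by (simp add: ennreal_mult_top divide_ennreal_def)
  next
    case False
    then have "0 < c" by (simp add: zero_less_iff_neq_zero)
    have "ennreal (norm x) / I K = inverse c * inverse (J x K)"
      if "x \<in> E\<^sup>\<bottom>" "x \<noteq> 0" "openin (top_of_set (half_space E x)) K" for x K
      unfolding I[OF that] using \<open>0 < c\<close> c(1) that by (intro ennreal_divide_scaled) auto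
    then show ?thesis
      using mult_left_mono[OF J, of "inverse c"] x0 x1 xl_perp nz \<open>x\<^sub>l \<noteq> 0\<close> open_K
      by (simp add: distrib_left ac_simps)
  qed
  then show ?thesis unfolding I_def Let_def .
qed

end
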